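(* Let $h_2$ be a local minimum trajectory, $\alpha>0$, $t_0\ge 0$ and $x_0\in\mathcal{M}(t_0)$, and put $e_0=x_0-h_2(t_0)$. Assume that the time-varying Lagrange function $L(x,\lambda,t)$ with $\lambda=\lambda(x,t)$ is locally $(c_2,r_2)$-one-point strongly convex with respect to $x$ around $h_2(t)$ in $\mathcal{M}(t)$. Let $\gamma(t)$ be such that $\|\dot h_2(t)\|\le\gamma(t)$, and suppose that there exist time-varying scalar functions $\delta_1(t),\delta_2(t)$ such that $$\|\mathcal{Q}(e+h_2(t),t)\,g'(e+h_2(t),t)\|\le\delta_1(t)\|e\|+\delta_2(t)$$ for all $t\ge t_0$ and all $e$ with $e+h_2(t)\in\mathcal{M}(t)$, $\|e\|\le r_2$, and positive constants $\eta_1,\eta_2$ such that $$\int_{t_0}^t\delta_1(\tau)\,d\tau\le\eta_1(t-t_0)+\eta_2\quad\text{for all }t\ge t_0.$$ If $\sup_{t\ge t_0}(\delta_2(t)+\gamma(t))$ is finite and $$\|x_0-h_2(t_0)\|\le\frac{r_2}{e^{\eta_2}},\qquad \alpha\le\frac{c_2r_2}{e^{\eta_2}\sup_{t\ge t_0}(\delta_2(t)+\gamma(t))+\eta_1r_2},$$ then the solution $x(t,t_0,x_0)$ of (P-ODE) $r_2$-tracks $h_2(t)$. More specifically, for all $t\ge t_0$, $$\|x(t,t_0,x_0)-h_2(t)\|\le e^{\eta_2}\|e_0\|e^{-(\frac{c_2}\alpha-\eta_1)(t-t_0)}+e^{\eta_2}\int_{t_0}^te^{-(\frac{c_2}\alpha-\eta_1)(t-\tau)}(\delta_2(\tau)+\gamma(\tau))\,d\tau\le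 r_2.$$
   Context: Time-varying problem: for each $t\ge 0$, minimize $f(x,t)$ over $x\in\mathbb{R}^n$ subject to $g(x,t)=0$, where $f:\mathbb{R}^n\times[0,\infty)\to\mathbb{R}$ and $g=(g_1,\dots,g_m)$ with $g_k:\mathbb{R}^n\times[0,\infty)\to\mathbb{R}$. Write $\mathcal{J}_g(x,t)=\partial g(x,t)/\partial x\in\mathbb{R}^{m\times n}$, $g'(x,t)=\partial g(x,t)/\partial t$, $\mathcal{M}(t)=\{x\in\mathbb{R}^n: g(x,t)=0\}$. $\|\cdot\|$ is the Euclidean norm and $\mathcal{B}_r(y)=\{x:\|x-y\|\le r\}$. Define $\mathcal{P}(x,t)=I_n-\mathcal{J}_g^\top(\mathcal{J}_g\mathcal{J}_g^\top)^{-1}\mathcal{J}_g$ and $\mathcal{Q}(x,t)=\mathcal{J}_g^\top(\mathcal{J}_g\mathcal{J}_g^\top)^{-1}$ (with $\mathcal{J}_g=\mathcal{J}_g(x,t)$), $\lambda(x,t)=-(\mathcal{J}_g\mathcal{J}_g^\top)^{-1}\mathcal{J}_g\nabla_x f(x,t)$, and $L(x,\lambda,t)=f(x,t)+\lambda^\top g(x,t)$. $\nabla_xL(x,\lambda(x,t),t)$ means: take the gradient in the first argument, then insert $\lambda=\lambda(x,t)$; it equals $\mathcal{P}(x,t)\nabla_xf(x,t)$. (P-ODE), with inertia $\alpha>0$: $\dot x(t)=-\frac1\alpha\mathcal{P}(x(t),t)\nabla_x f(x(t),t)-\mathcal{Q}(x(t),t)g'(x(t),t)$; $x(t,t_0,x_0)$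 is its solution with value $x_0$ at time $t_0$. A local minimum trajectory is a continuous map $h:I\to\mathbb{R}^n$, $I\subseteq[0,\infty)$, such that $h(t)$ is a local minimum of the problem at time $t$ for every $t\in I$. Standing assumptions. (A1) $f$ is twice continuously differentiable in $x$ and continuously differentiable in $t\ge0$; each $g_k$ is twice continuously differentiable in $x$ and twice continuously differentiable in $t\ge 0$; there is a constant $M$ with $f(x,t)\ge M$ for all $t\ge0$, $x\in\mathcal{M}(t)$. (A2) $\mathcal{M}(t)\neq\emptyset$ for all $t\ge0$. (A3) $\mathcal{J}_g(x,t)$ has full row rank for all $t\ge0$, $x\in\mathcal{M}(t)$. (A4) Each local minimum trajectory $h$ has domain $[0,\infty)$ and satisfies the second-order sufficient conditions uniformly, meaning that $\nabla^2_{xx}L(h(t),\lambda,t)$, $\lambda=\lambda(h(t),t)$, is positive definite on $\{y:\mathcal{J}_g(h(t),t)y=0\}$ for all $t\ge0$. Region of attraction: $RA^{\mathcal{M}(t)}(h(t))$ is the set of $x_0\in\mathcal{M}(t)$ such that the solution (with $t$ frozen) of $\frac{d\tilde x}{d\tilde t}=-\mathcal{P}(\tilde x(\tilde t),t)\nabla_xf(\tilde x(\tilde t),t)$, $\tilde x(0)=x_0$, satisfies $\lim_{\tilde t\to\infty}\tilde x(\tilde t)=h(t)$. Local one-point strong convexity: for $c,r>0$, $L$ is locally $(c,r)$-one-point strongly convex with respect to $x$ around $h(t)$ in $\mathcal{M}(t)$ if $e^\top\nabla_xL(e+h(t),\lambda(e+h(t),t),t)\ge c\|e\|^2$ for all $t\in[0,\infty)$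 and all $e$ with $e+h(t)\in\mathcal{M}(t)$, $\|e\|\le r$. Tracking: for $x_0\in\mathcal{M}(t_0)$ and $u>0$, $x(t,t_0,x_0)$ $u$-tracks $h_2(t)$ if there is a finite time $T>0$ such that for all $t\ge T$, $x(t,t_0,x_0)\in\mathcal{B}_u(h_2(t))\cap\mathcal{M}(t)$ and $\mathcal{B}_u(h_2(t))\cap\mathcal{M}(t)\subseteq RA^{\mathcal{M}(t)}(h_2(t))$.
   Formalization: The bound on the integral of δ1 is assumed from every starting time s ≥ t_0, i.e. ∫_s^t δ1 ≤ η1(t−s)+η2 for all t ≥ s ≥ t_0, not only for s = t_0; with t_0 fixed the claimed estimate is false (a late burst of δ1 can push the error beyond r_2). *)

theory Defs
  imports "HOL-Analysis.Analysis"
begin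

text \<open>
  Time-dependent data are curried functions of position and time; times are reals, and only
  times \<open>t \<ge> 0\<close> are ever used.
\<close>

definition grad :: "(real^'n \<Rightarrow> real) \<Rightarrow> real^'n \<Rightarrow> real^'n" where
  "grad \<phi> x = (\<chi> i. frechet_derivative \<phi> (at x) (axis i 1))"

definition hessian :: "(real^'n \<Rightarrow> real) \<Rightarrow> real^'n \<Rightarrow> real^'n^'n" where
  "hessian \<phi> x = jacobian (grad \<phi>) (at x)"

text \<open>Derivative of a function on \<open>[0, \<infinity>)\<close>; one-sided at \<open>0\<close>.\<close>

definition time_deriv :: "(real \<Rightarrow> 'a::real_normed_vector) \<Rightarrow> real \<Rightarrow> 'a" where
  "time_deriv u t = vector_derivative u (at t within {0..})"


text \<open>
  Continuity of the partial derivatives is joint continuity in \<open>(x, t)\<close>. Mixed partial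
  derivatives in \<open>x\<close> and \<open>t\<close> are not required to exist.
\<close>

definition C2_in_space :: "(real^'n \<Rightarrow> real \<Rightarrow> real) \<Rightarrow> bool" where
  "C2_in_space \<phi> \<longleftrightarrow>
     (\<forall>t\<ge>0. \<forall>x. (\<lambda>y. \<phi> y t) differentiable (at x) \<and> grad (\<lambda>y. \<phi> y t) differentiable (at x)) \<and>
     continuous_on (UNIV \<times> {0..}) (\<lambda>(x, t). grad (\<lambda>y. \<phi> y t) x) \<and>
     continuous_on (UNIV \<times> {0..}) (\<lambda>(x, t). hessian (\<lambda>y. \<phi> y t) x)"

definition C1_in_time :: "(real^'n \<Rightarrow> real \<Rightarrow> real) \<Rightarrow> bool" where
  "C1_in_time \<phi> \<longleftrightarrow>
     (\<forall>x. \<forall>t\<ge>0. \<phi> x differentiable (at t within {0..})) \<and>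
     continuous_on (UNIV \<times> {0..}) (\<lambda>(x, t). time_deriv (\<phi> x) t)"

definition C2_in_time :: "(real^'n \<Rightarrow> real \<Rightarrow> real) \<Rightarrow> bool" where
  "C2_in_time \<phi> \<longleftrightarrow> C1_in_time \<phi> \<and> C1_in_time (\<lambda>x. time_deriv (\<phi> x))"


definition feasible :: "(real^'n \<Rightarrow> real \<Rightarrow> real^'m) \<Rightarrow> real \<Rightarrow> (real^'n) set" where
  "feasible g t = {x. g x t = 0}"

definition Jg :: "(real^'n \<Rightarrow> real \<Rightarrow> real^'m) \<Rightarrow> real^'n \<Rightarrow> real \<Rightarrow> real^'n^'m" where
  "Jg g x t = jacobian (\<lambda>y. g y t) (at x)"

text \<open>
  \<open>matrix_inv\<close> is only meaningful where \<open>Jg g x t\<close> has full row rank, which the standing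
  assumptions guarantee on the feasible set.
\<close>

definition Qmat :: "(real^'n \<Rightarrow> real \<Rightarrow> real^'m) \<Rightarrow> real^'n \<Rightarrow> real \<Rightarrow> real^'m^'n" where
  "Qmat g x t = transpose (Jg g x t) ** matrix_inv (Jg g x t ** transpose (Jg g x t))"

definition Pmat :: "(real^'n \<Rightarrow> real \<Rightarrow> real^'m) \<Rightarrow> real^'n \<Rightarrow> real \<Rightarrow> real^'n^'n" where
  "Pmat g x t = mat 1 - transpose (Jg g x t) **
     matrix_inv (Jg g x t ** transpose (Jg g x t)) ** Jg g x t"

definition multiplier ::
  "(real^'n \<Rightarrow> real \<Rightarrow> real) \<Rightarrow> (real^'n \<Rightarrow> real \<Rightarrow> real^'m) \<Rightarrow> real^'n \<Rightarrow> real \<Rightarrow> real^'m" where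
  "multiplier f g x t =
     - ((matrix_inv (Jg g x t ** transpose (Jg g x t)) ** Jg g x t) *v grad (\<lambda>y. f y t) x)"

definition Lagr ::
  "(real^'n \<Rightarrow> real \<Rightarrow> real) \<Rightarrow> (real^'n \<Rightarrow> real \<Rightarrow> real^'m) \<Rightarrow> real^'n \<Rightarrow> real^'m \<Rightarrow> real \<Rightarrow> real"
  where
  "Lagr f g x lam t = f x t + lam \<bullet> g x t"

definition grad_Lagr ::
  "(real^'n \<Rightarrow> real \<Rightarrow> real) \<Rightarrow> (real^'n \<Rightarrow> real \<Rightarrow> real^'m) \<Rightarrow> real^'n \<Rightarrow> real^'m \<Rightarrow> real \<Rightarrow> real^'n"
  where
  "grad_Lagr f g x lam t = grad (\<lambda>y. Lagr f g y lam t) x"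

definition hess_Lagr ::
  "(real^'n \<Rightarrow> real \<Rightarrow> real) \<Rightarrow> (real^'n \<Rightarrow> real \<Rightarrow> real^'m) \<Rightarrow> real^'n \<Rightarrow> real^'m \<Rightarrow> real \<Rightarrow> real^'n^'n"
  where
  "hess_Lagr f g x lam t = hessian (\<lambda>y. Lagr f g y lam t) x"


definition local_minimum ::
  "(real^'n \<Rightarrow> real \<Rightarrow> real) \<Rightarrow> (real^'n \<Rightarrow> real \<Rightarrow> real^'m) \<Rightarrow> real \<Rightarrow> real^'n \<Rightarrow> bool" where
  "local_minimum f g t x \<longleftrightarrow> x \<in> feasible g t \<and>
     (\<exists>\<epsilon>>0. \<forall>y \<in> feasible g t. dist y x < \<epsilon> \<longrightarrow> f x t \<le> f y t)"

definition local_minimum_trajectory ::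
  "(real^'n \<Rightarrow> real \<Rightarrow> real) \<Rightarrow> (real^'n \<Rightarrow> real \<Rightarrow> real^'m) \<Rightarrow> real set \<Rightarrow> (real \<Rightarrow> real^'n) \<Rightarrow> bool"
  where
  "local_minimum_trajectory f g I h \<longleftrightarrow>
     I \<subseteq> {0..} \<and> continuous_on I h \<and> (\<forall>t\<in>I. local_minimum f g t (h t))"


definition smooth_problem ::
  "(real^'n \<Rightarrow> real \<Rightarrow> real) \<Rightarrow> (real^'n \<Rightarrow> real \<Rightarrow> real^'m) \<Rightarrow> bool" where
  "smooth_problem f g \<longleftrightarrow>
     C2_in_space f \<and> C1_in_time f \<and>
     (\<forall>k. C2_in_space (\<lambda>x t. g x t $ k) \<and> C2_in_time (\<lambda>x t. g x t $ k)) \<and>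
     (\<exists>M. \<forall>t\<ge>0. \<forall>x \<in> feasible g t. M \<le> f x t)"

definition always_feasible :: "(real^'n \<Rightarrow> real \<Rightarrow> real^'m) \<Rightarrow> bool" where
  "always_feasible g \<longleftrightarrow> (\<forall>t\<ge>0. feasible g t \<noteq> {})"

definition full_row_rank :: "(real^'n \<Rightarrow> real \<Rightarrow> real^'m) \<Rightarrow> bool" where
  "full_row_rank g \<longleftrightarrow> (\<forall>t\<ge>0. \<forall>x \<in> feasible g t. rank (Jg g x t) = CARD('m))"

definition uniform_SOSC ::
  "(real^'n \<Rightarrow> real \<Rightarrow> real) \<Rightarrow> (real^'n \<Rightarrow> real \<Rightarrow> real^'m) \<Rightarrow> (real \<Rightarrow> real^'n) \<Rightarrow> bool" where
  "uniform_SOSC f g h \<longleftrightarrow>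
     (\<forall>t\<ge>0. \<forall>y. Jg g (h t) t *v y = 0 \<and> y \<noteq> 0 \<longrightarrow>
        y \<bullet> (hess_Lagr f g (h t) (multiplier f g (h t) t) t *v y) > 0)"

text \<open>
  Since a restriction of a local minimum trajectory is again one, ``every local minimum
  trajectory has domain \<open>[0, \<infinity>)\<close>'' can only concern maximal trajectories: a trajectory over an
  interval is part of one over \<open>[0, \<infinity>)\<close>.
\<close>

definition regular_trajectories ::
  "(real^'n \<Rightarrow> real \<Rightarrow> real) \<Rightarrow> (real^'n \<Rightarrow> real \<Rightarrow> real^'m) \<Rightarrow> bool" where
  "regular_trajectories f g \<longleftrightarrow>
     (\<forall>I h. is_interval I \<and> I \<noteq> {} \<and> local_minimum_trajectory f g I h \<longrightarrow>
        (\<exists>H. local_minimum_trajectory f g {0..} H \<and> (\<forall>t\<in>I. H t = h t))) \<and>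
     (\<forall>h. local_minimum_trajectory f g {0..} h \<longrightarrow> uniform_SOSC f g h)"


definition P_ODE_solution ::
  "(real^'n \<Rightarrow> real \<Rightarrow> real) \<Rightarrow> (real^'n \<Rightarrow> real \<Rightarrow> real^'m) \<Rightarrow> real \<Rightarrow> real \<Rightarrow> real^'n \<Rightarrow>
     (real \<Rightarrow> real^'n) \<Rightarrow> bool" where
  "P_ODE_solution f g \<alpha> t0 x0 x \<longleftrightarrow> x t0 = x0 \<and>
     (\<forall>t\<ge>t0. (x has_vector_derivative
        - ((1 / \<alpha>) *\<^sub>R (Pmat g (x t) t *v grad (\<lambda>y. f y t) (x t)))
        - Qmat g (x t) t *v time_deriv (g (x t)) t) (at t within {t0..}))"

definition frozen_flow_solution ::
  "(real^'n \<Rightarrow> real \<Rightarrow> real) \<Rightarrow> (real^'n \<Rightarrow> real \<Rightarrow> real^'m) \<Rightarrow> real \<Rightarrow> real^'n \<Rightarrow>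
     (real \<Rightarrow> real^'n) \<Rightarrow> bool" where
  "frozen_flow_solution f g t x0 \<xi> \<longleftrightarrow> \<xi> 0 = x0 \<and>
     (\<forall>s\<ge>0. (\<xi> has_vector_derivative
        - (Pmat g (\<xi> s) t *v grad (\<lambda>y. f y t) (\<xi> s))) (at s within {0..}))"

text \<open>
  For a feasible starting point the frozen flow is unique under the standing assumptions: its
  vector field is continuously differentiable near the feasible set, which it leaves invariant.
\<close>

definition region_of_attraction ::
  "(real^'n \<Rightarrow> real \<Rightarrow> real) \<Rightarrow> (real^'n \<Rightarrow> real \<Rightarrow> real^'m) \<Rightarrow> real \<Rightarrow> real^'n \<Rightarrow> (real^'n) set"
  where
  "region_of_attraction f g t p =
     {x0 \<in> feasible g t. \<exists>\<xi>. frozen_flow_solution f g t x0 \<xi> \<and> (\<xi> \<longlongrightarrow> p) at_top}"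

definition one_point_strongly_convex ::
  "(real^'n \<Rightarrow> real \<Rightarrow> real) \<Rightarrow> (real^'n \<Rightarrow> real \<Rightarrow> real^'m) \<Rightarrow> real \<Rightarrow> real \<Rightarrow>
     (real \<Rightarrow> real^'n) \<Rightarrow> bool" where
  "one_point_strongly_convex f g c r h \<longleftrightarrow> c > 0 \<and> r > 0 \<and>
     (\<forall>t\<ge>0. \<forall>e. e + h t \<in> feasible g t \<and> norm e \<le> r \<longrightarrow>
        e \<bullet> grad_Lagr f g (e + h t) (multiplier f g (e + h t) t) t \<ge> c * (norm e)\<^sup>2)"

text \<open>
  The curve \<open>x\<close> matters only for large times, as \<open>T\<close> can always be enlarged beyond the initial
  time.
\<close>

definition tracks ::
  "(real^'n \<Rightarrow> real \<Rightarrow> real) \<Rightarrow> (real^'n \<Rightarrow> real \<Rightarrow> real^'m) \<Rightarrow> real \<Rightarrow>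
     (real \<Rightarrow> real^'n) \<Rightarrow> (real \<Rightarrow> real^'n) \<Rightarrow> bool" where
  "tracks f g u x h \<longleftrightarrow>
     (\<exists>T>0. \<forall>t\<ge>T. x t \<in> cball (h t) u \<inter> feasible g t \<and>
        cball (h t) u \<inter> feasible g t \<subseteq> region_of_attraction f g t (h t))"

end

theory Submission
  imports Defs "HOL-Complex_Analysis.Great_Picard"
begin

text \<open>
  Along a solution, \<open>g\<close> is constant, so the solution stays feasible; as long as the error
  \<open>e = x - h\<close> satisfies \<open>norm e \<le> r\<close>, one-point strong convexity gives
  \<open>e \<bullet> e' \<le> ((\<delta>1 - c / \<alpha>) * norm e + \<delta>2 + \<gamma>) * norm e\<close>, and a Gronwall argument with merely
  integrable coefficients yields the stated bound, which is at most \<open>r\<close> by the choice of \<open>\<alpha>\<close>.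
  Since nothing is known outside the ball of radius \<open>r\<close>, a solution could still leave it after
  touching its boundary; hence the error is shown to be strictly smaller than \<open>r\<close>. The field is
  only continuous in \<open>x\<close> (no mixed derivatives of \<open>g\<close>), so existence is Peano's theorem combined
  with this a priori confinement, and no uniqueness is used. The frozen gradient flow is treated in
  the same way and decays exponentially on the ball.
\<close>

section \<open>Barrier and Gronwall arguments\<close>

text \<open>The condition on \<alpha> amounts to \<open>exp \<eta>2 * S \<le> \<kappa> * r\<close>,
  where \<open>S\<close> is the supremum of \<delta>2 + \<gamma> and
  \<open>\<kappa> = c / \<alpha> - \<eta>1\<close>. With it the initial error contributes at most
  \<open>r * exp (- \<kappa> * (t - t0))\<close> and the source at most
  \<open>r * (1 - exp (- \<kappa> * (t - t0)))\<close>. These add up to exactly \<open>r\<close>: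
  the stated bound leaves no slack and cannot by itself exclude contact with the sphere. Strictness
  is drawn from what the bound gives away. If \<open>S > 0\<close>, the factor
  \<open>exp \<eta>2 > 1\<close> is too generous for sources released shortly before the final time.
  If \<open>S = 0\<close>, \<delta>1 can amplify only through the component of the error normal to
  the constraint, and that component is shorter than the error by a uniform factor. The integral of
  \<delta>1 is bounded on every subinterval, not only from \<open>t0\<close> on, because a source
  released at time \<open>s\<close> is propagated by \<delta>1 over \<open>{s..t}\<close>. Without
  uniqueness the a priori estimate has to cover every solution, and so does the conclusion.\<close>

lemma no_first_time:
  fixes C :: "real set"
  assumes "closed C" and step: "\<And>\<tau>. \<tau> \<in> {a..b} \<Longrightarrow> (\<And>s. s \<in> {a..<\<tau>} \<Longrightarrow> s \<notin> C) \<Longrightarrow> \<tau> \<notin> C"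
    and t: "t \<in> {a..b}"
  shows "t \<notin> C"
proof
  assume "t \<in> C"
  \<comment> \<open>Compactness yields a least bad time \<tau>. At \<tau> = a the hypothesis on
    earlier times is vacuous, so \<open>step\<close> covers the start as well.\<close>
  have "compact ({a..b} \<inter> C)" using \<open>closed C\<close> by (intro compact_Int_closed) auto
  moreover have "{a..b} \<inter> C \<noteq> {}" using \<open>t \<in> C\<close> t by auto
  ultimately obtain \<tau> where \<tau>: "\<tau> \<in> {a..b} \<inter> C" "\<And>s. s \<in> {a..b} \<inter> C \<Longrightarrow> \<tau> \<le> s"
    by (meson compact_attains_inf)
  have "s \<notin> C" if "s \<in> {a..<\<tau>}" for s
    using \<tau>(2)[of s] \<tau>(1) that by auto
  with step \<tau>(1) show False by blast
qed

text \<open>Upgrading a weak inequality to a strict one is enough: before the first time with \<rho>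
  \<ge> \<epsilon> the inequality is strict, continuity gives \<rho> \<le> \<epsilon> up to and
  including that time, and \<open>step\<close> then contradicts the choice of it.\<close>

lemma barrier:
  fixes \<rho> :: "real \<Rightarrow> real"
  assumes cont: "continuous_on {a..b} \<rho>" and start: "\<rho> a < \<epsilon>"
    and step: "\<And>\<tau>. \<tau> \<in> {a..b} \<Longrightarrow> (\<And>s. s \<in> {a..\<tau>} \<Longrightarrow> \<rho> s \<le> \<epsilon>) \<Longrightarrow> \<rho> \<tau> < \<epsilon>"
    and t: "t \<in> {a..b}"
  shows "\<rho> t < \<epsilon>"
proof -
  have "closed ({a..b} \<inter> \<rho> -` {\<epsilon>..})"
    by (rule continuous_closed_preimage[OF cont]) auto
  then have "t \<notin> {a..b} \<inter> \<rho> -` {\<epsilon>..}"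
  proof (rule no_first_time[OF _ _ t])
    fix \<tau> assume \<tau>: "\<tau> \<in> {a..b}" and before: "\<And>s. s \<in> {a..<\<tau>} \<Longrightarrow> s \<notin> {a..b} \<inter> \<rho> -` {\<epsilon>..}"
    have "\<rho> s \<le> \<epsilon>" if s: "s \<in> {a..\<tau>}" for s
    \<comment> \<open>For \<tau> = a the set \<open>{a..<\<tau>}\<close> is empty and its closure
      misses a; \<open>start\<close> takes care of that point.\<close>
    proof (cases "a < \<tau>")
      case True
      show ?thesis
      proof (rule continuous_le_on_closure[of "{a..<\<tau>}" \<rho>])
        show "continuous_on (closure {a..<\<tau>}) \<rho>"
          using True \<tau> by (auto intro: continuous_on_subset[OF cont])
        show "\<rho> s \<le> \<epsilon>" if "s \<in> {a..<\<tau>}" for s using before[OF that] that \<tau> by force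
      qed (use True s in simp)
    next
      case False
      then show ?thesis using start s by (cases "s = a") auto
    qed
    from step[OF \<tau> this] show "\<tau> \<notin> {a..b} \<inter> \<rho> -` {\<epsilon>..}" by auto
  qed
  then show ?thesis using t by auto
qed

lemma continuous_mult_absolutely_integrable:
  fixes f g :: "real \<Rightarrow> real"
  assumes f: "continuous_on {a..b} f" and g: "g absolutely_integrable_on {a..b}"
  shows "(\<lambda>x. f x * g x) absolutely_integrable_on {a..b}"
proof (rule absolutely_integrable_bounded_measurable_product_real[OF _ _ _ g])
  show "f \<in> borel_measurable (lebesgue_on {a..b})"
    by (rule continuous_imp_measurable_on_sets_lebesgue[OF f]) simp
  show "bounded (f ` {a..b})"
    by (rule compact_imp_bounded[OF compact_continuous_image[OF f compact_Icc]])
qed simp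

text \<open>Substitute for the sign of a derivative when \<open>G\<close> is not differentiable
  everywhere. On an equidistant partition of mesh below \<delta> the defects telescope to
  \<open>\<epsilon> * (V b - V a)\<close>, and \<epsilon> is arbitrary.\<close>

lemma antimono_endpoints_of_local_defect:
  fixes G V :: "real \<Rightarrow> real"
  assumes "a \<le> b"
    and local: "\<And>\<epsilon>. \<epsilon> > 0 \<Longrightarrow> \<exists>\<delta>>0. \<forall>s t. a \<le> s \<longrightarrow> s \<le> t \<longrightarrow> t \<le> b \<longrightarrow> t - s < \<delta> \<longrightarrow>
                  G t - G s \<le> \<epsilon> * (V t - V s)"
  shows "G b \<le> G a"
proof -
  have small: "G b - G a \<le> \<epsilon> * (V b - V a)" if "\<epsilon> > 0" for \<epsilon>
  proof -
    obtain \<delta> where \<delta>: "\<delta> > 0"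
      and step: "\<And>s t. a \<le> s \<Longrightarrow> s \<le> t \<Longrightarrow> t \<le> b \<Longrightarrow> t - s < \<delta> \<Longrightarrow> G t - G s \<le> \<epsilon> * (V t - V s)"
      using local[OF \<open>\<epsilon> > 0\<close>] by blast
    obtain N :: nat where N: "(b - a) / \<delta> < real N" using reals_Archimedean2 by blast
    have "0 \<le> (b - a) / \<delta>" using \<open>a \<le> b\<close> \<delta> by simp
    then have N0: "real N > 0" using N by linarith
    define p where "p i = a + (b - a) * (real i / real N)" for i
    have mono: "p i \<le> p (Suc i)" for i
      using \<open>a \<le> b\<close> N0 by (simp add: p_def divide_right_mono mult_left_mono)
    have gap: "p (Suc i) - p i < \<delta>" for i
    proof -
      have "p (Suc i) - p i = (b - a) / real N"
        by (simp add: p_def algebra_simps add_divide_distrib diff_divide_distrib)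
      also have "\<dots> < \<delta>" using N N0 \<delta> by (simp add: field_simps)
      finally show ?thesis .
    qed
    have lo: "a \<le> p i" for i using \<open>a \<le> b\<close> by (simp add: p_def)
    have hi: "p i \<le> b" if "i \<le> N" for i
    proof -
      have "(b - a) * (real i / real N) \<le> (b - a) * 1"
        using that N0 \<open>a \<le> b\<close> by (intro mult_left_mono) (auto simp: field_simps)
      then show ?thesis by (simp add: p_def)
    qed
    have "G (p k) - G (p 0) \<le> \<epsilon> * (V (p k) - V (p 0))" if "k \<le> N" for k
      using that
    proof (induction k)
      case (Suc k)
      have "G (p (Suc k)) - G (p k) \<le> \<epsilon> * (V (p (Suc k)) - V (p k))"
        using step[OF lo mono hi[OF Suc.prems] gap] .
      with Suc show ?case by (simp add: algebra_simps)
    qed simp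
    from this[of N] show ?thesis using N0 by (simp add: p_def)
  qed
  show ?thesis
  proof (rule ccontr)
    assume "\<not> ?thesis"
    then have d: "G b - G a > 0" by simp
    \<comment> \<open>Chosen so that \<open>\<epsilon> * (\<bar>V b - V a\<bar> + 1)\<close> is half
      of the assumed gap; the added 1 keeps the denominator positive when
      \<open>V b = V a\<close>.\<close>
    define \<epsilon> where "\<epsilon> = (G b - G a) / (2 * (\<bar>V b - V a\<bar> + 1))"
    have "\<epsilon> > 0" unfolding \<epsilon>_def using d by (intro divide_pos_pos) (auto intro: add_nonneg_pos)
    have "G b - G a \<le> \<epsilon> * (V b - V a)" by (rule small[OF \<open>\<epsilon> > 0\<close>])
    also have "\<dots> \<le> \<epsilon> * (\<bar>V b - V a\<bar> + 1)" using \<open>\<epsilon> > 0\<close> by (intro mult_left_mono) auto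
    also have "\<dots> = (G b - G a) / 2"
      by (simp add: \<epsilon>_def field_simps add_nonneg_eq_0_iff)
    finally show False using d by simp
  qed
qed

text \<open>The usual integrating factor \<open>E = exp (- A)\<close> works, but \<open>k\<close>
  and \<open>w\<close> are only integrable, so \<open>E * \<phi>\<close> cannot be differentiated.
  Instead the increments of \<open>G\<close> over short intervals are shown to be small against
  those of \<open>V\<close>, the integral of \<open>\<bar>k\<bar> + w\<close>. The inequality is
  assumed between any two times because \<open>k\<close> may be negative, where the version starting
  at \<open>a\<close> alone would not suffice.\<close>

lemma gronwall_integral_inequality:
  fixes \<phi> k w :: "real \<Rightarrow> real"
  assumes ab: "a \<le> b" and cont: "continuous_on {a..b} \<phi>" and nonneg: "\<And>t. t \<in> {a..b} \<Longrightarrow> 0 \<le> \<phi> t"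
    and k: "k absolutely_integrable_on {a..b}" and w: "w absolutely_integrable_on {a..b}"
    and w0: "\<And>t. t \<in> {a..b} \<Longrightarrow> 0 \<le> w t"
    and ineq: "\<And>s t. a \<le> s \<Longrightarrow> s \<le> t \<Longrightarrow> t \<le> b \<Longrightarrow>
       \<phi> t - \<phi> s \<le> integral {s..t} (\<lambda>\<tau>. \<phi> \<tau> * k \<tau> + w \<tau>)"
  shows "\<phi> b \<le> exp (integral {a..b} k) * \<phi> a + integral {a..b} (\<lambda>s. exp (integral {s..b} k) * w s)"
proof -
  define A where "A t = integral {a..t} k" for t
  have ki: "k integrable_on {s..t}" "(\<lambda>x. \<bar>k x\<bar>) integrable_on {s..t}" "w integrable_on {s..t}"
    if "a \<le> s" "t \<le> b" for s t
    using that absolutely_integrable_on_subinterval[OF k, of s t]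
      absolutely_integrable_on_subinterval[OF w, of s t]
    by (auto simp: absolutely_integrable_on_def)
  have contA: "continuous_on {a..b} A"
    unfolding A_def by (rule indefinite_integral_continuous_1) (use ki ab in auto)
  define E where "E t = exp (- A t)" for t
  have contE: "continuous_on {a..b} E" unfolding E_def by (intro continuous_intros contA)
  have Ew: "(\<lambda>x. E x * w x) integrable_on {s..t}" if "a \<le> s" "t \<le> b" for s t
    using absolutely_integrable_on_subinterval[OF continuous_mult_absolutely_integrable[OF contE w], of s t]
      that by (auto simp: absolutely_integrable_on_def)
  have pk: "(\<lambda>x. \<phi> x * k x) integrable_on {s..t}" if "a \<le> s" "t \<le> b" for s t
    using absolutely_integrable_on_subinterval[OF continuous_mult_absolutely_integrable[OF cont k], of s t]
      that by (auto simp: absolutely_integrable_on_def)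
  obtain M where M: "M > 0" "\<And>t. t \<in> {a..b} \<Longrightarrow> E t \<le> M"
  proof -
    have "bounded (E ` {a..b})"
      by (rule compact_imp_bounded[OF compact_continuous_image[OF contE compact_Icc]])
    then obtain M where "M > 0" "\<forall>y\<in>E ` {a..b}. norm y \<le> M" by (meson bounded_pos)
    then show ?thesis using that[of M] by (auto simp: E_def)
  qed
  have comb: "integral {a..s} h + integral {s..t} h = integral {a..t} h"
    if "a \<le> s" "s \<le> t" "h integrable_on {a..t}" for s t and h :: "real \<Rightarrow> real"
    using Henstock_Kurzweil_Integration.integral_combine[OF that] .
  define G where "G t = E t * \<phi> t - integral {a..t} (\<lambda>s. E s * w s)" for t
  define V where "V t = integral {a..t} (\<lambda>s. \<bar>k s\<bar> + w s)" for t
  have "G b \<le> G a"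
  proof (rule antimono_endpoints_of_local_defect[OF ab, where V=V])
    fix \<epsilon> :: real assume "\<epsilon> > 0"
    \<comment> \<open>Two errors have to stay below \<epsilon>: freezing \<phi> at \<open>s\<close>
      costs \<eta> times the factor \<open>E t \<le> M\<close>, and freezing \<open>E\<close> at
      \<open>t\<close> costs \<eta> alone. Dividing by \<open>M + 1\<close> serves both.\<close>
    define \<eta> where "\<eta> = \<epsilon> / (M + 1)"
    have \<eta>: "\<eta> > 0" using \<open>\<epsilon> > 0\<close> M by (simp add: \<eta>_def)
    have M\<eta>: "M * \<eta> \<le> \<epsilon>" "\<eta> \<le> \<epsilon>" using \<open>\<epsilon> > 0\<close> M by (auto simp: \<eta>_def field_simps)
    obtain d1 where d1: "d1 > 0" "\<And>s t. s \<in> {a..b} \<Longrightarrow> t \<in> {a..b} \<Longrightarrow> dist t s < d1 \<Longrightarrow> dist (\<phi> t) (\<phi> s) < \<eta>"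
      using compact_uniformly_continuous[OF cont compact_Icc] \<eta> unfolding uniformly_continuous_on_def by meson
    obtain d2 where d2: "d2 > 0" "\<And>s t. s \<in> {a..b} \<Longrightarrow> t \<in> {a..b} \<Longrightarrow> dist t s < d2 \<Longrightarrow> dist (E t) (E s) < \<eta>"
      using compact_uniformly_continuous[OF contE compact_Icc] \<eta> unfolding uniformly_continuous_on_def by meson
    show "\<exists>\<delta>>0. \<forall>s t. a \<le> s \<longrightarrow> s \<le> t \<longrightarrow> t \<le> b \<longrightarrow> t - s < \<delta> \<longrightarrow> G t - G s \<le> \<epsilon> * (V t - V s)"
    proof (intro exI[of _ "min d1 d2"] conjI allI impI)
      show "0 < min d1 d2" using d1 d2 by simp
      fix s t assume st: "a \<le> s" "s \<le> t" "t \<le> b" "t - s < min d1 d2"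
      have osc: "\<bar>\<phi> \<tau> - \<phi> s\<bar> \<le> \<eta>" "\<bar>E t - E \<tau>\<bar> \<le> \<eta>" if "\<tau> \<in> {s..t}" for \<tau>
        using d1(2)[of s \<tau>] d2(2)[of \<tau> t] that st by (auto simp: dist_real_def)
      have At: "A t - A s = integral {s..t} k"
        using comb[of s t k] st ki by (simp add: A_def)
      \<comment> \<open>The tangent bound of exp replaces the derivative of \<open>E\<close>: it
        bounds \<open>E s\<close> from below, and \<open>\<phi> s \<ge> 0\<close> turns this into an
        upper bound for the increment of \<open>E * \<phi>\<close>.\<close>
      have "E s = E t * exp (A t - A s)" by (simp add: E_def mult_exp_exp)
      moreover have "exp (A t - A s) \<ge> 1 + (A t - A s)" by (rule exp_ge_add_one_self)
      ultimately have Es: "E s \<ge> E t * (1 + (A t - A s))" by (simp add: E_def)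
      have "E t * \<phi> t - E s * \<phi> s \<le> E t * \<phi> t - E t * (1 + (A t - A s)) * \<phi> s"
        using mult_right_mono[OF Es nonneg[of s]] st by simp
      also have "\<dots> = E t * (\<phi> t - \<phi> s - \<phi> s * (A t - A s))" by (simp add: algebra_simps)
      also have "\<dots> \<le> E t * (integral {s..t} (\<lambda>\<tau>. \<phi> \<tau> * k \<tau> + w \<tau>) - \<phi> s * integral {s..t} k)"
        using ineq[OF st(1-3)] unfolding At by (intro mult_left_mono) (auto simp: E_def)
      also have "\<dots> = E t * integral {s..t} (\<lambda>\<tau>. (\<phi> \<tau> - \<phi> s) * k \<tau>) + E t * integral {s..t} w"
      proof -
        have d: "integral {s..t} (\<lambda>\<tau>. (\<phi> \<tau> - \<phi> s) * k \<tau>) = integral {s..t} (\<lambda>\<tau>. \<phi> \<tau> * k \<tau>) - \<phi> s * integral {s..t} k"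
          unfolding left_diff_distrib using st ki pk
          by (subst integral_diff) (auto intro: integrable_on_mult_right)
        have i: "integral {s..t} (\<lambda>\<tau>. \<phi> \<tau> * k \<tau> + w \<tau>) = integral {s..t} (\<lambda>\<tau>. \<phi> \<tau> * k \<tau>) + integral {s..t} w"
          using st ki pk by (subst integral_add) auto
        show ?thesis unfolding d i by (simp add: algebra_simps)
      qed
      also have "\<dots> \<le> M * (\<eta> * integral {s..t} (\<lambda>\<tau>. \<bar>k \<tau>\<bar>)) + E t * integral {s..t} w"
      proof -
        have "integral {s..t} (\<lambda>\<tau>. (\<phi> \<tau> - \<phi> s) * k \<tau>) \<le> integral {s..t} (\<lambda>\<tau>. \<eta> * \<bar>k \<tau>\<bar>)"
        proof (rule integral_le)
          show "(\<lambda>\<tau>. (\<phi> \<tau> - \<phi> s) * k \<tau>) integrable_on {s..t}"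
            unfolding left_diff_distrib using st ki pk
            by (intro integrable_diff) (auto intro: integrable_on_mult_right)
          show "(\<lambda>\<tau>. \<eta> * \<bar>k \<tau>\<bar>) integrable_on {s..t}" using st ki by (auto intro: integrable_on_mult_right)
          fix \<tau> assume "\<tau> \<in> {s..t}"
          have "(\<phi> \<tau> - \<phi> s) * k \<tau> \<le> \<bar>\<phi> \<tau> - \<phi> s\<bar> * \<bar>k \<tau>\<bar>" by (metis abs_ge_self abs_mult)
          also have "\<dots> \<le> \<eta> * \<bar>k \<tau>\<bar>" using osc[OF \<open>\<tau> \<in> {s..t}\<close>] by (intro mult_right_mono) auto
          finally show "(\<phi> \<tau> - \<phi> s) * k \<tau> \<le> \<eta> * \<bar>k \<tau>\<bar>" .
        qed
        then have "E t * integral {s..t} (\<lambda>\<tau>. (\<phi> \<tau> - \<phi> s) * k \<tau>) \<le> E t * (\<eta> * integral {s..t} (\<lambda>\<tau>. \<bar>k \<tau>\<bar>))"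
          by (intro mult_left_mono) (auto simp: E_def)
        also have "\<dots> \<le> M * (\<eta> * integral {s..t} (\<lambda>\<tau>. \<bar>k \<tau>\<bar>))"
          using M(2)[of t] st \<eta> ki by (intro mult_right_mono mult_nonneg_nonneg integral_nonneg) auto
        finally show ?thesis by simp
      qed
      also have "E t * integral {s..t} w \<le> integral {s..t} (\<lambda>\<tau>. E \<tau> * w \<tau>) + \<eta> * integral {s..t} w"
      proof -
        have "integral {s..t} (\<lambda>\<tau>. E t * w \<tau>) \<le> integral {s..t} (\<lambda>\<tau>. E \<tau> * w \<tau> + \<eta> * w \<tau>)"
        proof (rule integral_le)
          fix \<tau> assume t: "\<tau> \<in> {s..t}"
          have "E t * w \<tau> \<le> (E \<tau> + \<eta>) * w \<tau>" using osc(2)[OF t] w0[of \<tau>] t st by (intro mult_right_mono) auto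
          then show "E t * w \<tau> \<le> E \<tau> * w \<tau> + \<eta> * w \<tau>" by (simp add: algebra_simps)
        qed (use st ki Ew in \<open>auto intro!: integrable_on_mult_right integrable_add\<close>)
        also have "\<dots> = integral {s..t} (\<lambda>\<tau>. E \<tau> * w \<tau>) + \<eta> * integral {s..t} w"
          using st ki Ew by (subst integral_add) (auto intro: integrable_on_mult_right)
        finally show ?thesis by simp
      qed
      finally have main: "E t * \<phi> t - E s * \<phi> s \<le> M * \<eta> * integral {s..t} (\<lambda>\<tau>. \<bar>k \<tau>\<bar>)
          + integral {s..t} (\<lambda>\<tau>. E \<tau> * w \<tau>) + \<eta> * integral {s..t} w" by (simp add: algebra_simps)
      have "G t - G s = E t * \<phi> t - E s * \<phi> s - integral {s..t} (\<lambda>\<tau>. E \<tau> * w \<tau>)"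
        using comb[of s t "\<lambda>\<tau>. E \<tau> * w \<tau>"] st Ew by (simp add: G_def)
      also have "\<dots> \<le> M * \<eta> * integral {s..t} (\<lambda>\<tau>. \<bar>k \<tau>\<bar>) + \<eta> * integral {s..t} w" using main by simp
      also have "\<dots> \<le> \<epsilon> * integral {s..t} (\<lambda>\<tau>. \<bar>k \<tau>\<bar>) + \<epsilon> * integral {s..t} w"
        using M\<eta> st ki w0 by (intro add_mono mult_right_mono integral_nonneg) auto
      also have "\<dots> = \<epsilon> * (V t - V s)"
      proof -
        have "V t - V s = integral {s..t} (\<lambda>\<tau>. \<bar>k \<tau>\<bar> + w \<tau>)"
          using comb[of s t "\<lambda>\<tau>. \<bar>k \<tau>\<bar> + w \<tau>"] st ki by (simp add: V_def integrable_add)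
        also have "\<dots> = integral {s..t} (\<lambda>\<tau>. \<bar>k \<tau>\<bar>) + integral {s..t} w"
          using st ki by (subst integral_add) auto
        finally show ?thesis by (simp add: algebra_simps)
      qed
      finally show "G t - G s \<le> \<epsilon> * (V t - V s)" .
    qed
  qed
  then have "E b * \<phi> b \<le> \<phi> a + integral {a..b} (\<lambda>s. E s * w s)"
    by (simp add: G_def E_def A_def)
  then have "exp (A b) * (E b * \<phi> b) \<le> exp (A b) * (\<phi> a + integral {a..b} (\<lambda>s. E s * w s))"
    by (intro mult_left_mono) auto
  also have "exp (A b) * (E b * \<phi> b) = \<phi> b" by (simp add: E_def exp_minus)
  also have "exp (A b) * (\<phi> a + integral {a..b} (\<lambda>s. E s * w s))
      = exp (A b) * \<phi> a + integral {a..b} (\<lambda>s. exp (A b) * (E s * w s))"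
    by (simp add: distrib_left)
  also have "integral {a..b} (\<lambda>s. exp (A b) * (E s * w s)) = integral {a..b} (\<lambda>s. exp (integral {s..b} k) * w s)"
  proof (rule integral_cong)
    fix s assume s: "s \<in> {a..b}"
    have "A b - A s = integral {s..b} k" using comb[of s b k] s ki by (simp add: A_def)
    then have "exp (A b) * E s = exp (integral {s..b} k)" by (simp add: E_def mult_exp_exp)
    then show "exp (A b) * (E s * w s) = exp (integral {s..b} k) * w s" by (metis mult.assoc)
  qed
  finally show ?thesis by (simp add: A_def)
qed

text \<open>The norm is not differentiable at \<open>0\<close>; it is replaced by \<open>sqrt (norm\<^sup>2 + \<epsilon>\<^sup>2)\<close>, which costs
  at most \<open>\<epsilon> * integral \<bar>k\<bar>\<close> in the estimate.\<close>

lemma gronwall_norm: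
  fixes e :: "real \<Rightarrow> 'a::euclidean_space" and k w :: "real \<Rightarrow> real"
  assumes ab: "a \<le> b"
    and der: "\<And>t. t \<in> {a..b} \<Longrightarrow> (e has_vector_derivative e' t) (at t within {a..b})"
    and k: "k absolutely_integrable_on {a..b}" and w: "w absolutely_integrable_on {a..b}"
    and w0: "\<And>t. t \<in> {a..b} \<Longrightarrow> 0 \<le> w t"
    and ineq: "\<And>t. t \<in> {a..b} \<Longrightarrow> e t \<bullet> e' t \<le> (norm (e t) * k t + w t) * norm (e t)"
  shows "norm (e b) \<le> exp (integral {a..b} k) * norm (e a)
          + integral {a..b} (\<lambda>s. exp (integral {s..b} k) * w s)"
proof (rule gronwall_integral_inequality[OF ab _ _ k w w0])
  have conte: "continuous_on {a..b} e"
    using der by (meson continuous_on_eq_continuous_within has_vector_derivative_continuous)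
  then show cont: "continuous_on {a..b} (\<lambda>t. norm (e t))" by (intro continuous_intros)
  fix s t assume st: "a \<le> s" "s \<le> t" "t \<le> b"
  have sub: "{s..t} \<subseteq> {a..b}" using st by auto
  have pk: "(\<lambda>x. norm (e x) * k x) integrable_on {s..t}"
    using absolutely_integrable_on_subinterval[OF continuous_mult_absolutely_integrable[OF cont k], of s t]
      st by (auto simp: absolutely_integrable_on_def)
  have ki: "(\<lambda>x. \<bar>k x\<bar>) integrable_on {s..t}" "w integrable_on {s..t}"
    using st absolutely_integrable_on_subinterval[OF k, of s t]
      absolutely_integrable_on_subinterval[OF w, of s t]
    by (auto simp: absolutely_integrable_on_def)
  let ?I = "integral {s..t} (\<lambda>\<tau>. norm (e \<tau>) * k \<tau> + w \<tau>)"
  let ?K = "integral {s..t} (\<lambda>\<tau>. \<bar>k \<tau>\<bar>)"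
  have K0: "?K \<ge> 0" using ki by (intro integral_nonneg) auto
  \<comment> \<open>Of the factor \<open>?K + 1\<close>, the 1 pays for replacing the norm by \<psi>
    at the left end \<open>s\<close>; it also makes the later division by \<open>?K + 1\<close>
    legitimate.\<close>
  have eps: "norm (e t) - norm (e s) \<le> ?I + \<epsilon> * (?K + 1)" if "\<epsilon> > 0" for \<epsilon>
  proof -
    define \<psi> where "\<psi> \<tau> = sqrt (e \<tau> \<bullet> e \<tau> + \<epsilon>\<^sup>2)" for \<tau>
    have pos: "e \<tau> \<bullet> e \<tau> + \<epsilon>\<^sup>2 > 0" for \<tau> using \<open>\<epsilon> > 0\<close> by (simp add: add_nonneg_pos)
    have \<psi>pos: "\<psi> \<tau> > 0" for \<tau> unfolding \<psi>_def using pos[of \<tau>] by (rule real_sqrt_gt_zero)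
    have \<psi>lo: "norm (e \<tau>) \<le> \<psi> \<tau>" for \<tau>
      unfolding \<psi>_def norm_eq_sqrt_inner by (rule real_sqrt_le_mono) simp
    have \<psi>hi: "\<psi> \<tau> \<le> norm (e \<tau>) + \<epsilon>" for \<tau>
    proof -
      have "\<psi> \<tau> \<le> sqrt ((norm (e \<tau>) + \<epsilon>)\<^sup>2)" unfolding \<psi>_def
        using \<open>\<epsilon> > 0\<close> by (intro real_sqrt_le_mono) (simp add: dot_square_norm power2_sum)
      then show ?thesis using \<open>\<epsilon> > 0\<close> by simp
    qed
    have d\<psi>: "(\<psi> has_vector_derivative (e \<tau> \<bullet> e' \<tau> / \<psi> \<tau>)) (at \<tau> within {s..t})" if "\<tau> \<in> {s..t}" for \<tau>
    proof -
      have d: "(e has_derivative (\<lambda>h. h *\<^sub>R e' \<tau>)) (at \<tau> within {s..t})"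
        using has_vector_derivative_within_subset[OF der sub] that sub
        by (auto simp: has_vector_derivative_def)
      have "((\<lambda>\<tau>. e \<tau> \<bullet> e \<tau> + \<epsilon>\<^sup>2) has_derivative (\<lambda>h. e \<tau> \<bullet> (h *\<^sub>R e' \<tau>) + (h *\<^sub>R e' \<tau>) \<bullet> e \<tau>)) (at \<tau> within {s..t})"
        by (auto intro!: derivative_eq_intros d)
      then have "((\<lambda>\<tau>. e \<tau> \<bullet> e \<tau> + \<epsilon>\<^sup>2) has_real_derivative (2 * (e \<tau> \<bullet> e' \<tau>))) (at \<tau> within {s..t})"
        unfolding has_field_derivative_def
        by (rule has_derivative_eq_rhs) (auto simp: inner_commute fun_eq_iff algebra_simps)
      from DERIV_chain2[OF DERIV_real_sqrt[OF pos] this]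
      have "(\<psi> has_real_derivative (inverse (\<psi> \<tau>) / 2 * (2 * (e \<tau> \<bullet> e' \<tau>)))) (at \<tau> within {s..t})"
        unfolding \<psi>_def .
      then show ?thesis
        by (simp add: has_real_derivative_iff_has_vector_derivative field_simps)
    qed
    have hi: "((\<lambda>\<tau>. e \<tau> \<bullet> e' \<tau> / \<psi> \<tau>) has_integral (\<psi> t - \<psi> s)) {s..t}"
      by (rule fundamental_theorem_of_calculus[OF st(2) d\<psi>])
    have "\<psi> t - \<psi> s \<le> ?I + \<epsilon> * ?K"
    proof (rule has_integral_le[OF hi])
      show "((\<lambda>\<tau>. (norm (e \<tau>) * k \<tau> + w \<tau>) + \<epsilon> * \<bar>k \<tau>\<bar>) has_integral ?I + \<epsilon> * ?K) {s..t}"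
        using pk ki by (intro has_integral_add has_integral_mult_right integrable_integral integrable_add)
      fix \<tau> assume \<tau>: "\<tau> \<in> {s..t}"
      let ?n = "norm (e \<tau>)"
      have r: "0 \<le> ?n / \<psi> \<tau>" "?n / \<psi> \<tau> \<le> 1" using \<psi>pos[of \<tau>] \<psi>lo[of \<tau>] by auto
      have "?n * (1 - ?n / \<psi> \<tau>) = (?n / \<psi> \<tau>) * (\<psi> \<tau> - ?n)" using \<psi>pos[of \<tau>] by (simp add: field_simps)
      also have "\<dots> \<le> 1 * \<epsilon>" using r \<psi>lo[of \<tau>] \<psi>hi[of \<tau>] by (intro mult_mono) auto
      finally have small: "?n * (1 - ?n / \<psi> \<tau>) \<le> \<epsilon>" by simp
      have "e \<tau> \<bullet> e' \<tau> / \<psi> \<tau> \<le> (?n * k \<tau> + w \<tau>) * ?n / \<psi> \<tau>"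
        using ineq[of \<tau>] \<tau> sub \<psi>pos[of \<tau>] by (intro divide_right_mono) auto
      \<comment> \<open>The two errors of replacing \<open>?n / \<psi> \<tau>\<close> by 1 are
        separated: the one with \<open>w\<close> has a favourable sign and is dropped, the one with
        \<open>k\<close> is controlled by \<open>small\<close>.\<close>
      also have "\<dots> = ?n * k \<tau> + w \<tau> - (1 - ?n / \<psi> \<tau>) * w \<tau> - (?n * (1 - ?n / \<psi> \<tau>)) * k \<tau>"
        using \<psi>pos[of \<tau>] by (simp add: field_simps)
      also have "\<dots> \<le> ?n * k \<tau> + w \<tau> + \<epsilon> * \<bar>k \<tau>\<bar>"
      proof -
        have "0 \<le> (1 - ?n / \<psi> \<tau>) * w \<tau>" using r w0[of \<tau>] \<tau> sub by (intro mult_nonneg_nonneg) auto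
        moreover have "- ((?n * (1 - ?n / \<psi> \<tau>)) * k \<tau>) \<le> (?n * (1 - ?n / \<psi> \<tau>)) * \<bar>k \<tau>\<bar>"
        proof -
          have "0 \<le> ?n * (1 - ?n / \<psi> \<tau>)" using r by (intro mult_nonneg_nonneg) auto
          from mult_left_mono[OF abs_ge_minus_self[of "k \<tau>"] this] show ?thesis by simp
        qed
        moreover have "(?n * (1 - ?n / \<psi> \<tau>)) * \<bar>k \<tau>\<bar> \<le> \<epsilon> * \<bar>k \<tau>\<bar>"
          using small by (intro mult_right_mono) auto
        ultimately show ?thesis by linarith
      qed
      finally show "e \<tau> \<bullet> e' \<tau> / \<psi> \<tau> \<le> (?n * k \<tau> + w \<tau>) + \<epsilon> * \<bar>k \<tau>\<bar>" .
    qed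
    then show ?thesis using \<psi>lo[of t] \<psi>hi[of s] by (simp add: algebra_simps)
  qed
  show "norm (e t) - norm (e s) \<le> ?I"
  proof (rule field_le_epsilon)
    fix \<epsilon> :: real assume "\<epsilon> > 0"
    with K0 have "\<epsilon> / (?K + 1) > 0" by simp
    from eps[OF this] K0 show "norm (e t) - norm (e s) \<le> ?I + \<epsilon>" by simp
  qed
qed simp_all

section \<open>Confined solutions of differential equations\<close>

text \<open>Tonelli's approximation. The right-hand side at \<open>t\<close> sees \<open>y\<close>
  only up to \<open>t - d\<close> (clamped at \<open>a\<close>), so the iterates \<open>Y j\<close>
  become stationary on \<open>{a..a + j * d}\<close>. Finitely many steps of length \<open>d\<close>
  exhaust the interval, without a Lipschitz condition on \<open>F\<close>.\<close>

lemma delayed_integral_equation: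
  fixes F :: "'a::euclidean_space \<times> real \<Rightarrow> 'a"
  assumes cont: "continuous_on (UNIV \<times> {a..b}) F" and d: "d > 0"
  obtains y where "continuous_on {a..b} y"
    "\<And>t. t \<in> {a..b} \<Longrightarrow> y t = x0 + integral {a..t} (\<lambda>s. F (y (max a (s - d)), s))"
proof -
  define Y where "Y = rec_nat (\<lambda>_. x0) (\<lambda>_ y t. x0 + integral {a..t} (\<lambda>s. F (y (max a (s - d)), s)))"
  have Y0: "Y 0 = (\<lambda>_. x0)"
    and YS: "Y (Suc j) = (\<lambda>t. x0 + integral {a..t} (\<lambda>s. F (Y j (max a (s - d)), s)))" for j
    by (simp_all add: Y_def)
  have contY: "continuous_on {a..b} (Y j)" for j
  proof (induction j)
    case (Suc j)
    have "continuous_on {a..b} (\<lambda>s. F (Y j (max a (s - d)), s))"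
      using d by (intro continuous_on_compose2[OF cont] continuous_intros continuous_on_compose2[OF Suc]) auto
    then show ?case unfolding YS
      by (intro continuous_intros indefinite_integral_continuous_1 integrable_continuous_real)
  qed (simp add: Y0)
  have stable: "Y (Suc j) t = Y j t" if "t \<in> {a..b}" "t \<le> a + real j * d" for j t
    using that
  proof (induction j arbitrary: t)
    case 0
    then show ?case by (simp add: YS Y0)
  next
    case (Suc j)
    have "integral {a..t} (\<lambda>s. F (Y (Suc j) (max a (s - d)), s)) = integral {a..t} (\<lambda>s. F (Y j (max a (s - d)), s))"
    proof (rule integral_cong)
      fix s assume "s \<in> {a..t}"
      then have "Y (Suc j) (max a (s - d)) = Y j (max a (s - d))"
        using Suc.prems d by (intro Suc.IH) (auto simp: algebra_simps)
      then show "F (Y (Suc j) (max a (s - d)), s) = F (Y j (max a (s - d)), s)" by simp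
    qed
    then show ?case by (simp add: YS)
  qed
  obtain N :: nat where N: "(b - a) / d < real N" using reals_Archimedean2 by blast
  have "Y N t = x0 + integral {a..t} (\<lambda>s. F (Y N (max a (s - d)), s))" if t: "t \<in> {a..b}" for t
  proof -
    have "t \<le> a + real N * d" using N d t by (simp add: field_simps)
    from stable[OF t this] show ?thesis by (simp add: YS)
  qed
  then show ?thesis using that contY by blast
qed

text \<open>The delayed solutions share the Lipschitz constant \<open>B\<close>, so Arzela-Ascoli
  extracts a uniform limit as the delay tends to 0; dominated convergence passes to the limit in the
  integral equation. Boundedness of \<open>F\<close> on the whole space is arranged later by an
  extension argument.\<close>

theorem peano_existence:
  fixes F :: "'a::euclidean_space \<times> real \<Rightarrow> 'a"
  assumes ab: "a \<le> b" and cont: "continuous_on (UNIV \<times> {a..b}) F"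
    and bd: "\<And>z. z \<in> UNIV \<times> {a..b} \<Longrightarrow> norm (F z) \<le> B"
  obtains x where "x a = x0"
    "\<And>t. t \<in> {a..b} \<Longrightarrow> (x has_vector_derivative F (x t, t)) (at t within {a..b})"
proof -
  define d where "d n = 1 / real (Suc n)" for n
  have d: "d n > 0" for n by (simp add: d_def)
  have "B \<ge> 0" using bd[of "(0, a)"] norm_ge_zero[of "F (0, a)"] ab by (simp del: norm_ge_zero)
  have "\<forall>n. \<exists>y. continuous_on {a..b} y \<and>
      (\<forall>t\<in>{a..b}. y t = x0 + integral {a..t} (\<lambda>s. F (y (max a (s - d n)), s)))"
    using delayed_integral_equation[OF cont d, of x0] by metis
  from choice[OF this] obtain y where conty: "\<And>n. continuous_on {a..b} (y n)"
    and y: "\<And>n t. t \<in> {a..b} \<Longrightarrow> y n t = x0 + integral {a..t} (\<lambda>s. F (y n (max a (s - d n)), s))"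
    by blast
  define f where "f n s = F (y n (max a (s - d n)), s)" for n s
  have contf: "continuous_on {a..b} (f n)" for n
    unfolding f_def using d[of n]
    by (intro continuous_on_compose2[OF cont] continuous_intros continuous_on_compose2[OF conty]) auto
  have fB: "norm (f n s) \<le> B" if "s \<in> {a..b}" for n s
    unfolding f_def using that by (intro bd) auto
  have lip0: "norm (y n t - y n s) \<le> B * (t - s)" if "a \<le> s" "s \<le> t" "t \<le> b" for n s t
  proof -
    have c: "continuous_on {s..t} (f n)" "continuous_on {a..t} (f n)"
      by (rule continuous_on_subset[OF contf], use that in force)+
    have "y n t = x0 + integral {a..t} (f n)" "y n s = x0 + integral {a..s} (f n)"
      using y[of t n] y[of s n] that by (auto simp: f_def[abs_def])
    moreover have "integral {a..s} (f n) + integral {s..t} (f n) = integral {a..t} (f n)"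
      using that integrable_continuous_real[OF c(2)]
      by (intro Henstock_Kurzweil_Integration.integral_combine) auto
    ultimately have "y n t - y n s = integral {s..t} (f n)"
      by (metis add_diff_cancel_left add_diff_cancel_left')
    then show ?thesis using integral_bound[OF that(2) c(1), of B] fB that by auto
  qed
  have lip: "norm (y n t - y n s) \<le> B * \<bar>t - s\<bar>" if "s \<in> {a..b}" "t \<in> {a..b}" for n s t
    using lip0[of s t n] lip0[of t s n] that by (cases "s \<le> t") (auto simp: norm_minus_commute)
  obtain g k where g: "continuous_on {a..b} g" and k: "strict_mono (k :: nat \<Rightarrow> nat)"
    and unif: "\<And>e. 0 < e \<Longrightarrow> \<exists>N. \<forall>n x. n \<ge> N \<and> x \<in> {a..b} \<longrightarrow> norm (y (k n) x - g x) < e"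
  proof (rule Arzela_Ascoli[of "{a..b}" y "norm x0 + B * (b - a)"])
    fix n t assume t: "t \<in> {a..b}"
    have "y n a = x0" using y[of a n] ab by simp
    then have "norm (y n t) \<le> norm x0 + norm (y n t - y n a)" by (metis norm_triangle_sub)
    also have "\<dots> \<le> norm x0 + B * (b - a)"
      using lip0[of a t n] t mult_left_mono[of "t - a" "b - a" B] \<open>B \<ge> 0\<close> by auto
    finally show "norm (y n t) \<le> norm x0 + B * (b - a)" .
  next
    fix t e :: real assume t: "t \<in> {a..b}" and e: "0 < e"
    show "\<exists>d>0. \<forall>n s. s \<in> {a..b} \<and> norm (t - s) < d \<longrightarrow> norm (y n t - y n s) < e"
    proof (intro exI[of _ "e / (B + 1)"] conjI allI impI)
      show "e / (B + 1) > 0" using e \<open>B \<ge> 0\<close> by simp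
      fix n s assume s: "s \<in> {a..b} \<and> norm (t - s) < e / (B + 1)"
      have "norm (y n t - y n s) \<le> B * \<bar>t - s\<bar>" using lip[of s t n] s t by auto
      also have "\<dots> \<le> (B + 1) * \<bar>t - s\<bar>" by (intro mult_right_mono) auto
      also have "\<dots> < e" using s \<open>B \<ge> 0\<close> by (simp add: field_simps)
      finally show "norm (y n t - y n s) < e" .
    qed
  qed auto
  have ptw: "(\<lambda>n. y (k n) s) \<longlonglongrightarrow> g s" if "s \<in> {a..b}" for s
    using unif that by (simp add: LIMSEQ_iff) meson
  have dk: "(\<lambda>n. d (k n)) \<longlonglongrightarrow> 0"
    using LIMSEQ_subseq_LIMSEQ[OF LIMSEQ_inverse_real_of_nat k]
    by (simp add: d_def o_def inverse_eq_divide)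
  \<comment> \<open>The common Lipschitz constant makes the effect of the delay at most
    \<open>B * d (k n)\<close>.\<close>
  have delayed: "(\<lambda>n. y (k n) (max a (s - d (k n)))) \<longlonglongrightarrow> g s" if s: "s \<in> {a..b}" for s
  proof -
    have "(\<lambda>n. y (k n) (max a (s - d (k n))) - y (k n) s) \<longlonglongrightarrow> 0"
    proof (rule Lim_null_comparison)
      show "(\<lambda>n. B * d (k n)) \<longlonglongrightarrow> 0" using tendsto_mult_right_zero[OF dk] by simp
      show "\<forall>\<^sub>F n in sequentially. norm (y (k n) (max a (s - d (k n))) - y (k n) s) \<le> B * d (k n)"
      proof (rule always_eventually, rule allI)
        fix n
        have "norm (y (k n) (max a (s - d (k n))) - y (k n) s) \<le> B * \<bar>max a (s - d (k n)) - s\<bar>"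
          using s d[of "k n"] by (intro lip) auto
        also have "\<dots> \<le> B * d (k n)" using s d[of "k n"] \<open>B \<ge> 0\<close> by (intro mult_left_mono) auto
        finally show "norm (y (k n) (max a (s - d (k n))) - y (k n) s) \<le> B * d (k n)" .
      qed
    qed
    from tendsto_add[OF this ptw[OF s]] show ?thesis by simp
  qed
  have contFg: "continuous_on {a..b} (\<lambda>s. F (g s, s))"
    by (intro continuous_on_compose2[OF cont] continuous_intros g) auto
  have geq: "g t = x0 + integral {a..t} (\<lambda>s. F (g s, s))" if t: "t \<in> {a..b}" for t
  proof -
    have "(\<lambda>n. integral {a..t} (f (k n))) \<longlonglongrightarrow> integral {a..t} (\<lambda>s. F (g s, s))"
    proof (rule dominated_convergence(2)[where h = "\<lambda>_. B"])
      show "f (k n) integrable_on {a..t}" for n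
        by (intro integrable_continuous_real continuous_on_subset[OF contf]) (use t in auto)
      show "norm (f (k n) s) \<le> B" if "s \<in> {a..t}" for n s using that t fB by auto
      fix s assume "s \<in> {a..t}"
      then have s: "s \<in> {a..b}" using t by auto
      have "(\<lambda>n. (y (k n) (max a (s - d (k n))), s)) \<longlonglongrightarrow> (g s, s)"
        by (intro tendsto_Pair delayed[OF s] tendsto_const)
      from continuous_on_tendsto_compose[OF cont this] s
      show "(\<lambda>n. f (k n) s) \<longlonglongrightarrow> F (g s, s)" by (simp add: f_def)
    qed auto
    then have "(\<lambda>n. y (k n) t) \<longlonglongrightarrow> x0 + integral {a..t} (\<lambda>s. F (g s, s))"
      using y[OF t] by (auto simp: f_def[abs_def] intro: tendsto_add)
    with ptw[OF t] show ?thesis by (rule LIMSEQ_unique)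
  qed
  show ?thesis
  proof (rule that)
    show "g a = x0" using geq[of a] ab by simp
    fix t assume t: "t \<in> {a..b}"
    have "((\<lambda>u. x0 + integral {a..u} (\<lambda>s. F (g s, s))) has_vector_derivative F (g t, t)) (at t within {a..b})"
      using integral_has_vector_derivative[OF contFg t] by (auto intro!: derivative_eq_intros)
    then show "(g has_vector_derivative F (g t, t)) (at t within {a..b})"
      by (rule has_vector_derivative_transform[OF t, rotated]) (rule geq)
  qed
qed

text \<open>Peano's theorem needs a bounded field on the whole space. \<open>F\<close> is restricted
  to a compact neighbourhood of \<open>K\<close> inside \<open>W\<close> and extended by Tietze to
  \<open>G\<close>. As long as a solution for \<open>G\<close> stays in that neighbourhood it solves
  the equation for \<open>F\<close>, so the a priori hypothesis puts it in \<open>K\<close>, and the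
  barrier argument on the distance to \<open>K\<close> prevents an escape.\<close>

lemma confined_solution_exists:
  fixes F :: "'a::euclidean_space \<times> real \<Rightarrow> 'a"
  assumes ab: "a \<le> b" and W: "openin (top_of_set (UNIV \<times> {a..b})) W" and cont: "continuous_on W F"
    and K: "compact K" "K \<subseteq> W" and start: "(x0, a) \<in> K"
    and apriori: "\<And>x T. T \<in> {a..b} \<Longrightarrow> x a = x0 \<Longrightarrow>
       (\<And>t. t \<in> {a..T} \<Longrightarrow> (x has_vector_derivative F (x t, t)) (at t within {a..T})) \<Longrightarrow>
       (\<And>t. t \<in> {a..T} \<Longrightarrow> (x t, t) \<in> W) \<Longrightarrow> (x T, T) \<in> K"
  obtains x where "x a = x0"
    "\<And>t. t \<in> {a..b} \<Longrightarrow> (x has_vector_derivative F (x t, t)) (at t within {a..b})"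
    "\<And>t. t \<in> {a..b} \<Longrightarrow> (x t, t) \<in> K"
proof -
  obtain V where V: "open V" "W = (UNIV \<times> {a..b}) \<inter> V" using W unfolding openin_open by auto
  obtain \<epsilon> where \<epsilon>: "\<epsilon> > 0" "{z. infdist z K \<le> \<epsilon>} \<subseteq> V"
    using compact_in_open_separated[of K V] K start V by blast
  \<comment> \<open>The neighbourhood has to be cut to the time slab, since \<open>W\<close> is open
    only relative to it.\<close>
  define N where "N = {z. infdist z K \<le> \<epsilon>} \<inter> (UNIV \<times> {a..b})"
  have NW: "N \<subseteq> W" using \<epsilon> V by (auto simp: N_def)
  have "compact N"
    unfolding N_def using compact_infdist_le[OF _ \<open>compact K\<close> \<open>\<epsilon> > 0\<close>] start
    by (intro compact_Int_closed) (auto intro: closed_Times)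
  have contN: "continuous_on N F" using cont NW by (rule continuous_on_subset)
  obtain B where B: "B \<ge> 0" "\<And>z. z \<in> N \<Longrightarrow> norm (F z) \<le> B"
    using compact_imp_bounded[OF compact_continuous_image[OF contN \<open>compact N\<close>]]
    by (auto simp: bounded_pos) (meson less_imp_le)
  obtain G where G: "continuous_on UNIV G" "\<And>z. z \<in> N \<Longrightarrow> G z = F z" "\<And>z. norm (G z) \<le> B"
    using Tietze[OF contN _ B, of UNIV] compact_imp_closed[OF \<open>compact N\<close>] by (metis UNIV_I closed_closedin subtopology_UNIV)
  obtain x where x: "x a = x0"
    "\<And>t. t \<in> {a..b} \<Longrightarrow> (x has_vector_derivative G (x t, t)) (at t within {a..b})"
    using peano_existence[OF ab continuous_on_subset[OF G(1)] G(3), of x0] by blast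
  have contx: "continuous_on {a..b} x"
    using x(2) by (meson continuous_on_eq_continuous_within has_vector_derivative_continuous)
  define \<rho> where "\<rho> t = infdist (x t, t) K" for t
  have cont\<rho>: "continuous_on {a..b} \<rho>" unfolding \<rho>_def by (intro continuous_intros contx)
  have inK: "(x t, t) \<in> K" if t: "t \<in> {a..b}" and le: "\<And>s. s \<in> {a..t} \<Longrightarrow> \<rho> s \<le> \<epsilon>" for t
  proof (rule apriori[where x = x, OF t x(1)])
    fix s assume s: "s \<in> {a..t}"
    then have "(x s, s) \<in> N" using t le[OF s] by (auto simp: N_def \<rho>_def)
    then show "(x s, s) \<in> W" using NW by auto
    have "(x has_vector_derivative G (x s, s)) (at s within {a..t})"
      using s t by (intro has_vector_derivative_within_subset[OF x(2)]) auto
    then show "(x has_vector_derivative F (x s, s)) (at s within {a..t})"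
      using G(2) \<open>(x s, s) \<in> N\<close> by simp
  qed
  have small: "\<rho> t < \<epsilon>" if t: "t \<in> {a..b}" for t
  proof (rule barrier[OF cont\<rho> _ _ t])
    show "\<rho> a < \<epsilon>" using x(1) start \<open>\<epsilon> > 0\<close> by (simp add: \<rho>_def)
    show "\<rho> \<tau> < \<epsilon>" if "\<tau> \<in> {a..b}" "\<And>s. s \<in> {a..\<tau>} \<Longrightarrow> \<rho> s \<le> \<epsilon>" for \<tau>
      using inK[OF that] \<open>\<epsilon> > 0\<close> by (simp add: \<rho>_def)
  qed
  show ?thesis
  proof (rule that[of x, OF x(1)])
    fix t assume t: "t \<in> {a..b}"
    show K': "(x t, t) \<in> K" using t less_imp_le[OF small] by (intro inK) auto
    have "(x t, t) \<in> N" using K' t \<open>\<epsilon> > 0\<close> by (simp add: N_def)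
    then show "(x has_vector_derivative F (x t, t)) (at t within {a..b})"
      using x(2)[OF t] G(2) by simp
  qed
qed

lemma has_vector_derivative_concat:
  fixes x y :: "real \<Rightarrow> 'a::real_normed_vector"
  assumes "a \<le> b" "b \<le> c" "x b = y b"
    and x: "\<And>t. t \<in> {a..b} \<Longrightarrow> (x has_vector_derivative F (x t, t)) (at t within {a..b})"
    and y: "\<And>t. t \<in> {b..c} \<Longrightarrow> (y has_vector_derivative F (y t, t)) (at t within {b..c})"
    and t: "t \<in> {a..c}"
  shows "((\<lambda>t. if t \<in> {a..b} then x t else y t) has_vector_derivative
     F (if t \<in> {a..b} then x t else y t, t)) (at t within {a..c})"
proof -
  have "((\<lambda>t. if t \<in> {a..b} then x t else y t) has_vector_derivative
     (if t \<in> {a..b} then F (x t, t) else F (y t, t))) (at t within {a..c})"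
  proof (rule has_vector_derivative_If_within_closures[where T = "{b..c}"])
    have *: "{a..b} \<union> closure {a..b} \<inter> closure {b..c} = {a..b}"
      "{b..c} \<union> closure {a..b} \<inter> closure {b..c} = {b..c}" by auto
    show "(x has_vector_derivative F (x t, t)) (at t within {a..b} \<union> closure {a..b} \<inter> closure {b..c})"
      if "t \<in> {a..b} \<union> closure {a..b} \<inter> closure {b..c}"
      using that x unfolding * by blast
    show "(y has_vector_derivative F (y t, t)) (at t within {b..c} \<union> closure {a..b} \<inter> closure {b..c})"
      if "t \<in> {b..c} \<union> closure {a..b} \<inter> closure {b..c}"
      using that y unfolding * by blast
  qed (use assms in \<open>auto simp: order.antisym\<close>)
  moreover have "(if t \<in> {a..b} then F (x t, t) else F (y t, t)) = F (if t \<in> {a..b} then x t else y t, t)" by simp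
  ultimately show ?thesis by (simp only:)
qed

text \<open>Without uniqueness, solutions on longer and longer intervals need not extend one
  another. Dependent choice builds a coherent sequence, each member continuing its predecessor by
  one unit of time.\<close>

theorem confined_global_solution_exists:
  fixes F :: "'a::euclidean_space \<times> real \<Rightarrow> 'a"
  assumes W: "openin (top_of_set (UNIV \<times> {a..})) W" and cont: "continuous_on W F"
    and K: "\<And>b. compact (K \<inter> UNIV \<times> {a..b})" "K \<subseteq> W" and start: "(x0, a) \<in> K"
    and apriori: "\<And>x T. T \<ge> a \<Longrightarrow> x a = x0 \<Longrightarrow>
       (\<And>t. t \<in> {a..T} \<Longrightarrow> (x has_vector_derivative F (x t, t)) (at t within {a..T})) \<Longrightarrow>
       (\<And>t. t \<in> {a..T} \<Longrightarrow> (x t, t) \<in> W) \<Longrightarrow> (x T, T) \<in> K"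
  obtains x where "x a = x0"
    "\<And>t. t \<ge> a \<Longrightarrow> (x has_vector_derivative F (x t, t)) (at t within {a..})"
    "\<And>t. t \<ge> a \<Longrightarrow> (x t, t) \<in> K"
proof -
  define P where "P n x \<longleftrightarrow> x a = x0 \<and> (\<forall>t\<in>{a..a + real n}.
     (x has_vector_derivative F (x t, t)) (at t within {a..a + real n}) \<and> (x t, t) \<in> K)" for n x
  have "\<exists>X. \<forall>n. P n (X n) \<and> (\<forall>t\<in>{a..a + real n}. X (Suc n) t = X n t)"
  proof (rule dependent_nat_choice)
    show "\<exists>x. P 0 x"
      using start by (intro exI[of _ "\<lambda>_. x0"])
        (auto simp: P_def has_vector_derivative_def has_derivative_within_singleton_iff
              intro: bounded_linear_scaleR_left)
  next
    fix x n assume "P n x"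
    define b where "b = a + real n"
    have ab: "a \<le> b" by (simp add: b_def)
    have x: "x a = x0" "\<And>t. t \<in> {a..b} \<Longrightarrow> (x has_vector_derivative F (x t, t)) (at t within {a..b})"
      "\<And>t. t \<in> {a..b} \<Longrightarrow> (x t, t) \<in> K" using \<open>P n x\<close> by (auto simp: P_def b_def)
    define W' where "W' = W \<inter> UNIV \<times> {b..b + 1}"
    define K' where "K' = (K \<inter> UNIV \<times> {a..b + 1}) \<inter> UNIV \<times> {b..}"
    obtain y where y: "y b = x b"
      "\<And>t. t \<in> {b..b + 1} \<Longrightarrow> (y has_vector_derivative F (y t, t)) (at t within {b..b + 1})"
      "\<And>t. t \<in> {b..b + 1} \<Longrightarrow> (y t, t) \<in> K'"
    proof (rule confined_solution_exists[of b "b + 1" W' F K' "x b"])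
      show "openin (top_of_set (UNIV \<times> {b..b + 1})) W'"
        unfolding W'_def using W ab unfolding openin_open by fastforce
      show "continuous_on W' F" using cont by (rule continuous_on_subset) (auto simp: W'_def)
      show "compact K'" unfolding K'_def by (intro compact_Int_closed K closed_Times) auto
      show "K' \<subseteq> W'" using K by (auto simp: K'_def W'_def)
      show "(x b, b) \<in> K'" using x(3)[of b] ab by (simp add: K'_def)
      fix y T assume T: "T \<in> {b..b + 1}" and y: "y b = x b"
        "\<And>t. t \<in> {b..T} \<Longrightarrow> (y has_vector_derivative F (y t, t)) (at t within {b..T})"
        "\<And>t. t \<in> {b..T} \<Longrightarrow> (y t, t) \<in> W'"
      \<comment> \<open>The a priori hypothesis speaks of curves started at \<open>a\<close>, so the
        candidate on \<open>{b..T}\<close> is glued to the piece already built before it is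
        applied.\<close>
      define z where "z = (\<lambda>t. if t \<in> {a..b} then x t else y t)"
      have "(z T, T) \<in> K"
      proof (rule apriori)
        show "a \<le> T" "z a = x0" using T ab x by (auto simp: z_def)
        fix t assume t: "t \<in> {a..T}"
        show "(z has_vector_derivative F (z t, t)) (at t within {a..T})"
          unfolding z_def using T by (intro has_vector_derivative_concat ab x y t) (auto simp: y)
        show "(z t, t) \<in> W" using t x(3)[of t] y(3)[of t] K by (auto simp: z_def W'_def)
      qed
      then show "(y T, T) \<in> K'" using T ab y(1) by (auto simp: z_def K'_def split: if_splits dest: order.antisym)
    qed auto
    define z where "z = (\<lambda>t. if t \<in> {a..b} then x t else y t)"
    have "P (Suc n) z"
      unfolding P_def
    proof (intro conjI ballI)
      show "z a = x0" using x ab by (simp add: z_def)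
      fix t assume t: "t \<in> {a..a + real (Suc n)}"
      have e: "a + real (Suc n) = b + 1" by (simp add: b_def)
      show "(z has_vector_derivative F (z t, t)) (at t within {a..a + real (Suc n)})"
        unfolding z_def e using t unfolding e by (intro has_vector_derivative_concat ab x y) (auto simp: y)
      show "(z t, t) \<in> K" using t x(3)[of t] y(3)[of t] unfolding e by (auto simp: z_def K'_def)
    qed
    moreover have "\<forall>t\<in>{a..a + real n}. z t = x t" by (simp add: z_def b_def)
    ultimately show "\<exists>y. P (Suc n) y \<and> (\<forall>t\<in>{a..a + real n}. y t = x t)" by blast
  qed
  then obtain X where P: "\<And>n. P n (X n)" and ext: "\<And>n t. t \<in> {a..a + real n} \<Longrightarrow> X (Suc n) t = X n t"
    by blast
  have agree: "X m t = X n t" if "n \<le> m" "t \<in> {a..a + real n}" for m n t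
    using that by (induction m rule: dec_induct) (auto simp: ext)
  define x where "x t = X (nat \<lceil>t - a\<rceil>) t" for t
  have xX: "x t = X n t" if "t \<in> {a..a + real n}" for n t
  proof -
    have "nat \<lceil>t - a\<rceil> \<le> n" using that by (auto simp: ceiling_le_iff nat_le_iff)
    moreover have "t \<in> {a..a + real (nat \<lceil>t - a\<rceil>)}" using that real_nat_ceiling_ge[of "t - a"]
      unfolding atLeastAtMost_iff by linarith
    ultimately show ?thesis unfolding x_def by (rule agree[symmetric])
  qed
  show ?thesis
  proof (rule that)
    show "x a = x0" using xX[of a 0] P[of 0] by (simp add: P_def)
    fix t assume t: "t \<ge> a"
    \<comment> \<open>The strict inequality keeps \<open>t\<close> away from the right end, so that
      derivatives within \<open>{a..a + real n}\<close> and within \<open>{a..}\<close> coincide at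
      \<open>t\<close>.\<close>
    obtain n :: nat where "t - a < real n" using reals_Archimedean2 by blast
    then have tn: "t \<in> {a..a + real n}" "t \<in> {..<a + real n}" using t by auto
    then show "(x t, t) \<in> K" using P[of n] xX[OF tn(1)] by (simp add: P_def)
    have "(X n has_vector_derivative F (x t, t)) (at t within {a..a + real n})"
      using P[of n] tn(1) xX[OF tn(1)] by (simp add: P_def)
    then have "(x has_vector_derivative F (x t, t)) (at t within {a..a + real n})"
      by (rule has_vector_derivative_transform[OF tn(1), rotated]) (rule xX)
    moreover have "at t within {a..} = at t within {a..a + real n}"
      by (rule at_within_nhd[OF tn(2)]) auto
    ultimately show "(x has_vector_derivative F (x t, t)) (at t within {a..})" by simp
  qed
qed

section \<open>Constraint geometry\<close>

lemma grad_unique: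
  assumes "(\<phi> has_derivative (\<lambda>h. v \<bullet> h)) (at x)"
  shows "grad \<phi> x = v"
  by (simp add: grad_def vec_eq_iff inner_axis frechet_derivative_at[OF assms, symmetric])

lemma has_derivative_grad:
  assumes "\<phi> differentiable (at x)"
  shows "(\<phi> has_derivative (\<lambda>h. grad \<phi> x \<bullet> h)) (at x)"
proof -
  let ?D = "frechet_derivative \<phi> (at x)"
  have D: "(\<phi> has_derivative ?D) (at x)" using assms by (simp add: frechet_derivative_works)
  interpret linear ?D using has_derivative_linear[OF D] .
  have "?D h = grad \<phi> x \<bullet> h" for h
  proof -
    have "?D h = ?D (\<Sum>i\<in>UNIV. h $ i *\<^sub>R axis i 1)"
      using basis_expansion[of h] by (simp add: scalar_mult_eq_scaleR)
    also have "\<dots> = (\<Sum>i\<in>UNIV. h $ i * ?D (axis i 1))" by (simp add: sum scale)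
    finally show ?thesis by (simp add: grad_def inner_vec_def mult.commute)
  qed
  then have "?D = (\<lambda>h. grad \<phi> x \<bullet> h)" by auto
  with D show ?thesis by simp
qed

text \<open>Includes the endpoint \<open>t = c\<close>; this is what makes the one-sided time
  derivative at 0 unique.\<close>

lemma at_within_Ici_nontrivial: "t \<ge> c \<Longrightarrow> at t within {c..} \<noteq> bot" for t c :: real
proof
  assume "t \<ge> c" "at t within {c..} = bot"
  moreover have "at_right t \<le> at t within {c..}" using \<open>t \<ge> c\<close> by (intro at_le) auto
  ultimately have "at_right t = bot" by (simp add: bot_unique)
  then show False using trivial_limit_at_right_real[of t] by blast
qed

lemma time_deriv_unique:
  assumes "(u has_vector_derivative d) (at t within {0..})" "t \<ge> 0"
  shows "time_deriv u t = d"
  unfolding time_deriv_def by (rule vector_derivative_within[OF at_within_Ici_nontrivial[OF assms(2)] assms(1)])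

lemma has_vector_derivative_time_deriv:
  "u differentiable (at t within {0..}) \<Longrightarrow> (u has_vector_derivative time_deriv u t) (at t within {0..})"
  unfolding time_deriv_def by (rule vector_derivative_works[THEN iffD1])

lemma has_vector_derivative_vec_nth_iff:
  fixes u :: "real \<Rightarrow> real^'m"
  shows "(u has_vector_derivative d) (at t within S) \<longleftrightarrow>
    (\<forall>k. ((\<lambda>t. u t $ k) has_vector_derivative d $ k) (at t within S))"
  unfolding has_vector_derivative_def
  by (subst has_derivative_componentwise_within) (auto simp: Basis_vec_def inner_axis)

section \<open>Continuity of matrix operations and the Gram matrix\<close>

lemma continuous_on_matrix_vector_mult:
  fixes A :: "'z::topological_space \<Rightarrow> real^'n^'m"
  assumes "continuous_on S A" "continuous_on S b"
  shows "continuous_on S (\<lambda>z. A z *v b z)"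
  unfolding matrix_vector_mult_def using assms by (intro continuous_intros)

lemma continuous_on_transpose:
  fixes A :: "'z::topological_space \<Rightarrow> real^'n^'m"
  assumes "continuous_on S A"
  shows "continuous_on S (\<lambda>z. transpose (A z))"
  unfolding transpose_def using assms by (intro continuous_intros)

lemma continuous_on_matrix_mult:
  fixes A :: "'z::topological_space \<Rightarrow> real^'n^'m" and B :: "'z \<Rightarrow> real^'k^'n"
  assumes "continuous_on S A" "continuous_on S B"
  shows "continuous_on S (\<lambda>z. A z ** B z)"
  unfolding matrix_matrix_mult_def using assms by (intro continuous_intros)

lemma continuous_on_det:
  fixes A :: "'z::topological_space \<Rightarrow> real^'n^'n"
  assumes "continuous_on S A"
  shows "continuous_on S (\<lambda>z. det (A z))"
  unfolding det_def using assms by (intro continuous_intros)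

lemma matrix_inv_inverse:
  fixes A :: "real^'n^'n"
  assumes "det A \<noteq> 0"
  shows "A ** matrix_inv A = mat 1" "matrix_inv A ** A = mat 1"
proof -
  have "\<exists>B. A ** B = mat 1 \<and> B ** A = mat 1"
    using assms invertible_det_nz[of A] by (simp add: invertible_def)
  from someI_ex[OF this] show "A ** matrix_inv A = mat 1" "matrix_inv A ** A = mat 1"
    by (simp_all add: matrix_inv_def)
qed

text \<open>\<open>matrix_inv\<close> is defined by choice, so its continuity cannot be read off.
  Cramer's rule writes the product as a quotient of determinants, which are polynomials in the
  entries.\<close>

lemma continuous_on_matrix_inv_vector_mult:
  fixes A :: "'z::topological_space \<Rightarrow> real^'n^'n"
  assumes A: "continuous_on S A" and b: "continuous_on S b" and nz: "\<And>z. z \<in> S \<Longrightarrow> det (A z) \<noteq> 0"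
  shows "continuous_on S (\<lambda>z. matrix_inv (A z) *v b z)"
proof -
  have "matrix_inv (A z) *v b z = (\<chi> k. det (\<chi> i j. if j = k then b z $ i else A z $ i $ j) / det (A z))"
    if "z \<in> S" for z
  proof (rule cramer[OF nz[OF that], THEN iffD1])
    show "A z *v (matrix_inv (A z) *v b z) = b z"
      by (simp only: matrix_vector_mul_assoc matrix_inv_inverse(1)[OF nz[OF that]] matrix_vector_mul_lid)
  qed
  moreover have "continuous_on S (\<lambda>z. \<chi> k. det (\<chi> i j. if j = k then b z $ i else A z $ i $ j) / det (A z))"
  proof (intro continuous_intros continuous_on_det A)
    fix k i j
    show "continuous_on S (\<lambda>z. if j = k then b z $ i else A z $ i $ j)"
      using A b by (cases "j = k") (auto intro!: continuous_intros)
  qed (use nz in auto)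
  ultimately show ?thesis by (subst continuous_on_cong[OF refl]) assumption+
qed

lemma inner_transpose_matrix_vector:
  fixes A :: "real^'n^'m"
  shows "x \<bullet> (transpose A *v z) = (A *v x) \<bullet> z"
  by (metis dot_lmul_matrix inner_commute transpose_matrix_vector)

text \<open>If the Gram matrix annihilates \<open>y\<close>, then the squared norm of
  \<open>transpose A *v y\<close> is \<open>((A ** transpose A) *v y) \<bullet> y = 0\<close>, and
  \<open>transpose A\<close> is injective by full row rank.\<close>

lemma full_row_rank_gram_det:
  fixes A :: "real^'n^'m"
  assumes "rank A = CARD('m)"
  shows "det (A ** transpose A) \<noteq> 0"
proof -
  have "inj ((*v) (transpose A))" using assms by (simp add: full_rank_injective[symmetric] rank_transpose)
  have "y = 0" if "(A ** transpose A) *v y = 0" for y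
  proof -
    have "(transpose A *v y) \<bullet> (transpose A *v y) = (A *v (transpose A *v y)) \<bullet> y"
      by (rule inner_transpose_matrix_vector)
    also have "\<dots> = 0" using that by (simp add: matrix_vector_mul_assoc del: transpose_matrix_vector)
    finally have "transpose A *v y = transpose A *v 0" by simp
    with \<open>inj _\<close> show "y = 0" by (simp only: inj_eq)
  qed
  then have "\<exists>B. B ** (A ** transpose A) = mat 1" by (simp add: matrix_left_invertible_ker)
  then show ?thesis by (simp add: invertible_left_inverse invertible_det_nz[symmetric])
qed

lemma Qmat_mult: "Qmat g x t *v y =
    transpose (Jg g x t) *v (matrix_inv (Jg g x t ** transpose (Jg g x t)) *v y)"
  by (simp only: Qmat_def matrix_vector_mul_assoc)

lemma Pmat_mult: "Pmat g x t *v y = y - Qmat g x t *v (Jg g x t *v y)"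
  by (simp only: Pmat_def Qmat_def matrix_vector_mult_diff_rdistrib matrix_vector_mul_assoc matrix_mul_assoc
      matrix_vector_mul_lid)


section \<open>Derivatives of the problem data in space and time\<close>

context
  fixes f :: "real^'n \<Rightarrow> real \<Rightarrow> real" and g :: "real^'n \<Rightarrow> real \<Rightarrow> real^'m"
  assumes smooth: "smooth_problem f g"
begin

lemma differentiable_f: "t \<ge> 0 \<Longrightarrow> (\<lambda>y. f y t) differentiable (at x)"
  and differentiable_g: "t \<ge> 0 \<Longrightarrow> (\<lambda>y. g y t $ k) differentiable (at x)"
  and continuous_grad_f: "continuous_on (UNIV \<times> {0..}) (\<lambda>(x, t). grad (\<lambda>y. f y t) x)"
  and continuous_grad_g: "continuous_on (UNIV \<times> {0..}) (\<lambda>(x, t). grad (\<lambda>y. g y t $ k) x)"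
  and time_differentiable_g: "t \<ge> 0 \<Longrightarrow> (\<lambda>t. g x t $ k) differentiable (at t within {0..})"
  and continuous_time_deriv_g_nth: "continuous_on (UNIV \<times> {0..}) (\<lambda>(x, t). time_deriv (\<lambda>t. g x t $ k) t)"
  using smooth by (auto simp: smooth_problem_def C2_in_space_def C2_in_time_def C1_in_time_def)

lemma Jg_nth: "Jg g x t $ k = grad (\<lambda>y. g y t $ k) x"
  and has_derivative_Jg: "((\<lambda>y. g y t) has_derivative (\<lambda>h. Jg g x t *v h)) (at x)"
  if "t \<ge> 0"
proof -
  let ?A = "\<chi> k. grad (\<lambda>y. g y t $ k) x"
  have "((\<lambda>y. g y t) has_derivative (\<lambda>h. ?A *v h)) (at x)"
  proof (rule has_derivative_componentwise_within[THEN iffD2], rule ballI)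
    fix b :: "real^'m" assume "b \<in> Basis"
    then obtain k where "b = axis k 1" by (auto simp: Basis_vec_def)
    then show "((\<lambda>y. g y t \<bullet> b) has_derivative (\<lambda>h. (?A *v h) \<bullet> b)) (at x)"
      using has_derivative_grad[OF differentiable_g[OF that]]
      by (simp add: inner_axis matrix_vector_mul_component)
  qed
  moreover from this have "Jg g x t = ?A"
    unfolding Jg_def jacobian_def using frechet_derivative_at by (metis matrix_of_matrix_vector_mul)
  ultimately show "Jg g x t $ k = grad (\<lambda>y. g y t $ k) x"
    "((\<lambda>y. g y t) has_derivative (\<lambda>h. Jg g x t *v h)) (at x)" by auto
qed

lemma time_deriv_g_nth:
  assumes t: "t \<ge> 0"
  shows "time_deriv (g x) t $ k = time_deriv (\<lambda>t. g x t $ k) t"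
proof -
  have "(g x has_vector_derivative (\<chi> k. time_deriv (\<lambda>t. g x t $ k) t)) (at t within {0..})"
    unfolding has_vector_derivative_vec_nth_iff
    using has_vector_derivative_time_deriv[OF time_differentiable_g[OF t]] by simp
  from time_deriv_unique[OF this t] show ?thesis by simp
qed

lemma continuous_time_deriv_g: "continuous_on (UNIV \<times> {0..}) (\<lambda>(x, t). time_deriv (g x) t)"
proof -
  have "continuous_on (UNIV \<times> {0..}) (\<lambda>z. \<chi> k. time_deriv (\<lambda>t. g (fst z) t $ k) (snd z))"
    using continuous_time_deriv_g_nth by (intro continuous_intros) (auto simp: case_prod_beta)
  then show ?thesis
    by (rule continuous_on_eq) (auto simp: vec_eq_iff time_deriv_g_nth)
qed

lemma continuous_Jg: "continuous_on (UNIV \<times> {0..}) (\<lambda>(x, t). Jg g x t)"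
proof -
  have "continuous_on (UNIV \<times> {0..}) (\<lambda>z. \<chi> k. grad (\<lambda>y. g y (snd z) $ k) (fst z))"
  proof (rule continuous_on_vec_lambda)
    fix k show "continuous_on (UNIV \<times> {0..}) (\<lambda>z. grad (\<lambda>y. g y (snd z) $ k) (fst z))"
      using continuous_grad_g[of k] by (simp add: case_prod_beta)
  qed
  then show ?thesis
    by (rule continuous_on_eq) (auto simp: vec_eq_iff Jg_nth)
qed

text \<open>One partial derivative at the point together with joint continuity of the other gives
  the total derivative. Time is the first component because the partial required to be continuous is
  the one in the second argument, here the space gradient.\<close>

lemma has_derivative_g_nth:
  assumes t: "t \<ge> 0"
  shows "((\<lambda>(s, y). g y s $ k) has_derivative
      (\<lambda>(ts, ty). ts *\<^sub>R time_deriv (\<lambda>s. g x s $ k) t + grad (\<lambda>y. g y t $ k) x \<bullet> ty))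
      (at (t, x) within {0..} \<times> UNIV)"
  unfolding blinfun_inner_right.rep_eq[symmetric]
proof (rule has_derivative_partialsI[where fy = "\<lambda>s y. blinfun_inner_right (grad (\<lambda>y. g y s $ k) y)"])
  show "((\<lambda>s. g x s $ k) has_derivative (\<lambda>ts. ts *\<^sub>R time_deriv (\<lambda>s. g x s $ k) t)) (at t within {0..})"
    using has_vector_derivative_time_deriv[OF time_differentiable_g[OF t]]
    by (simp add: has_vector_derivative_def)
  show "((\<lambda>y. g y s $ k) has_derivative blinfun_apply (blinfun_inner_right (grad (\<lambda>y. g y s $ k) y))) (at y within UNIV)"
    if "s \<in> {0..}" for s y
    using has_derivative_grad[OF differentiable_g, of s k y] that by simp
  have "continuous_on ({0..} \<times> UNIV) (\<lambda>z. grad (\<lambda>y. g y (fst z) $ k) (snd z))"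
    by (rule continuous_on_compose2[OF continuous_grad_g[of k], of _ "\<lambda>z. (snd z, fst z)", simplified])
       (auto intro!: continuous_intros)
  then have "continuous_on ({0..} \<times> UNIV) (\<lambda>z. blinfun_inner_right (grad (\<lambda>y. g y (fst z) $ k) (snd z)))"
    by (intro bounded_linear.continuous_on[OF bounded_linear_blinfun_inner_right])
  then show "continuous (at (t, x) within {0..} \<times> UNIV) (\<lambda>(s, y). blinfun_inner_right (grad (\<lambda>y. g y s $ k) y))"
    using t unfolding continuous_on_eq_continuous_within case_prod_beta by blast
qed (use t in auto)

lemma continuous_on_g: "continuous_on (UNIV \<times> {0..}) (\<lambda>z. g (fst z) (snd z))"
proof -
  have "continuous_on ({0..} \<times> UNIV) (\<lambda>z. g (snd z) (fst z) $ k)" for k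
    unfolding continuous_on_eq_continuous_within
    using has_derivative_continuous[OF has_derivative_g_nth] unfolding case_prod_beta by force
  then have "continuous_on (UNIV \<times> {0..}) (\<lambda>z. g (fst z) (snd z) $ k)" for k
    by (rule continuous_on_compose2[where g = "\<lambda>z. g (snd z) (fst z) $ k" and f = "\<lambda>z. (snd z, fst z)", simplified])
       (auto intro!: continuous_intros)
  then have "continuous_on (UNIV \<times> {0..}) (\<lambda>z. \<chi> k. g (fst z) (snd z) $ k)" by (rule continuous_on_vec_lambda)
  then show ?thesis by simp
qed

text \<open>Chain rule along the graph of the curve. Everything is taken within nonnegative times,
  so a start at time 0 is covered.\<close>

lemma has_vector_derivative_along_curve:
  assumes x: "(x has_vector_derivative v) (at t within S)" and t: "t \<in> S" and S: "S \<subseteq> {0..}"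
  shows "((\<lambda>s. g (x s) s) has_vector_derivative (Jg g (x t) t *v v + time_deriv (g (x t)) t)) (at t within S)"
  unfolding has_vector_derivative_vec_nth_iff
proof
  fix k
  have t0: "t \<ge> 0" using t S by auto
  have outer: "((\<lambda>(s, y). g y s $ k) has_derivative
      (\<lambda>(ts, ty). ts *\<^sub>R time_deriv (\<lambda>s. g (x t) s $ k) t + grad (\<lambda>y. g y t $ k) (x t) \<bullet> ty))
      (at (t, x t) within (\<lambda>s. (s, x s)) ` S)"
    by (rule has_derivative_subset[OF has_derivative_g_nth[OF t0]]) (use S in auto)
  have "((\<lambda>s. (s, x s)) has_derivative (\<lambda>h. (h, h *\<^sub>R v))) (at t within S)"
    using x unfolding has_vector_derivative_def by (intro derivative_intros)
  from has_derivative_in_compose[OF this outer]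
  show "((\<lambda>s. g (x s) s $ k) has_vector_derivative (Jg g (x t) t *v v + time_deriv (g (x t)) t) $ k) (at t within S)"
    using t0 by (simp add: has_vector_derivative_def matrix_vector_mul_component Jg_nth time_deriv_g_nth algebra_simps)
qed

text \<open>Translates one-point strong convexity into a statement about the projected gradient,
  which drives both flows. The multiplier is a constant vector while differentiating, so the
  gradient is that of \<open>f\<close> plus \<open>transpose ?J *v ?l\<close>; inserting the formula
  for \<open>?l\<close> subtracts the normal part.\<close>

lemma grad_Lagr_eq_Pmat:
  assumes "t \<ge> 0"
  shows "grad_Lagr f g x (multiplier f g x t) t = Pmat g x t *v grad (\<lambda>y. f y t) x"
proof -
  let ?l = "multiplier f g x t" and ?J = "Jg g x t"
  have "((\<lambda>y. f y t + ?l \<bullet> g y t) has_derivative (\<lambda>h. grad (\<lambda>y. f y t) x \<bullet> h + ?l \<bullet> (?J *v h))) (at x)"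
    using has_derivative_grad[OF differentiable_f[OF assms]] has_derivative_Jg[OF assms]
    by (auto intro!: derivative_eq_intros)
  moreover have "grad (\<lambda>y. f y t) x \<bullet> h + ?l \<bullet> (?J *v h) = (grad (\<lambda>y. f y t) x + transpose ?J *v ?l) \<bullet> h" for h
    using inner_transpose_matrix_vector[of h ?J ?l] unfolding inner_add_left
    by (simp add: inner_commute del: transpose_matrix_vector)
  ultimately have "((\<lambda>y. f y t + ?l \<bullet> g y t) has_derivative (\<lambda>h. (grad (\<lambda>y. f y t) x + transpose ?J *v ?l) \<bullet> h)) (at x)"
    by (simp only:)
  then have "grad_Lagr f g x ?l t = grad (\<lambda>y. f y t) x + transpose ?J *v ?l"
    unfolding grad_Lagr_def Lagr_def by (rule grad_unique)
  also have "transpose ?J *v ?l = - (Qmat g x t *v (?J *v grad (\<lambda>y. f y t) x))"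
    unfolding multiplier_def Qmat_mult linear_neg[OF matrix_vector_mul_linear]
    by (simp add: matrix_vector_mul_assoc del: transpose_matrix_vector)
  finally show ?thesis by (simp add: Pmat_mult)
qed

end

section \<open>Regular points and the splitting into tangential and normal parts\<close>

definition regular_points :: "(real^'n \<Rightarrow> real \<Rightarrow> real^'m) \<Rightarrow> ((real^'n) \<times> real) set" where
  "regular_points g = {z. snd z \<ge> 0 \<and> det (Jg g (fst z) (snd z) ** transpose (Jg g (fst z) (snd z))) \<noteq> 0}"

lemma regular_points_subset: "regular_points g \<subseteq> UNIV \<times> {0..}"
  by (auto simp: regular_points_def)

text \<open>Expressing full row rank through the Gram determinant makes it an open condition, as the
  existence theorems require of the domain of the field; the feasible set itself is not
  open.\<close>

lemma openin_regular_points: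
  assumes "smooth_problem f g"
  shows "openin (top_of_set (UNIV \<times> {0..})) (regular_points g)"
proof -
  have "continuous_on (UNIV \<times> {0..}) (\<lambda>z. det (Jg g (fst z) (snd z) ** transpose (Jg g (fst z) (snd z))))"
    using continuous_Jg[OF assms]
    by (intro continuous_on_det continuous_on_matrix_mult continuous_on_transpose) (auto simp: case_prod_beta)
  then have "openin (top_of_set (UNIV \<times> {0..})) ((UNIV \<times> {0..}) \<inter>
     (\<lambda>z. det (Jg g (fst z) (snd z) ** transpose (Jg g (fst z) (snd z)))) -` (- {0}))"
    by (rule continuous_openin_preimage_gen) auto
  also have "(UNIV \<times> {0..}) \<inter> (\<lambda>z. det (Jg g (fst z) (snd z) ** transpose (Jg g (fst z) (snd z)))) -` (- {0})
      = regular_points g" by (auto simp: regular_points_def)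
  finally show ?thesis .
qed

lemma feasible_regular:
  "full_row_rank g \<Longrightarrow> t \<ge> 0 \<Longrightarrow> x \<in> feasible g t \<Longrightarrow> (x, t) \<in> regular_points g"
  by (auto simp: full_row_rank_def regular_points_def intro!: full_row_rank_gram_det)

lemma continuous_on_Qmat_mult:
  assumes "smooth_problem f g" "continuous_on (regular_points g) b"
  shows "continuous_on (regular_points g) (\<lambda>z. Qmat g (fst z) (snd z) *v b z)"
proof -
  have J: "continuous_on (regular_points g) (\<lambda>z. Jg g (fst z) (snd z))"
    using continuous_on_subset[OF continuous_Jg[OF assms(1)] regular_points_subset]
    by (simp add: case_prod_beta)
  show ?thesis unfolding Qmat_mult
    by (intro continuous_on_matrix_vector_mult continuous_on_transpose continuous_on_matrix_inv_vector_mult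
        continuous_on_matrix_mult J assms) (auto simp: regular_points_def)
qed

lemma continuous_on_Pmat_mult:
  assumes "smooth_problem f g" "continuous_on (regular_points g) b"
  shows "continuous_on (regular_points g) (\<lambda>z. Pmat g (fst z) (snd z) *v b z)"
proof -
  have J: "continuous_on (regular_points g) (\<lambda>z. Jg g (fst z) (snd z))"
    using continuous_on_subset[OF continuous_Jg[OF assms(1)] regular_points_subset]
    by (simp add: case_prod_beta)
  show ?thesis unfolding Pmat_mult
    by (intro continuous_on_diff continuous_on_Qmat_mult[OF assms(1)] continuous_on_matrix_vector_mult J assms(2))
qed

lemma Jg_Qmat:
  assumes "(x, t) \<in> regular_points g"
  shows "Jg g x t *v (Qmat g x t *v y) = y"
proof -
  let ?A = "Jg g x t ** transpose (Jg g x t)"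
  have "Jg g x t *v (Qmat g x t *v y) = (?A ** matrix_inv ?A) *v y"
    by (simp only: Qmat_mult matrix_vector_mul_assoc matrix_mul_assoc)
  also have "?A ** matrix_inv ?A = mat 1"
    using assms by (intro matrix_inv_inverse) (simp add: regular_points_def)
  finally show ?thesis by simp
qed

lemma Jg_Pmat:
  assumes "(x, t) \<in> regular_points g"
  shows "Jg g x t *v (Pmat g x t *v y) = 0"
  using Jg_Qmat[OF assms] by (simp add: Pmat_mult matrix_vector_mult_diff_distrib)

text \<open>\<open>Qmat\<close> takes values in the range of the transposed Jacobian and
  \<open>Pmat\<close> in the kernel of the Jacobian. With \<open>Pmat_plus_Qmat\<close> this splits
  every vector orthogonally into a tangential and a normal part.\<close>

lemma Pmat_orthogonal_Qmat:
  assumes "(x, t) \<in> regular_points g"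
  shows "(Pmat g x t *v y) \<bullet> (Qmat g x t *v z) = 0"
  by (simp add: Qmat_mult inner_transpose_matrix_vector Jg_Pmat[OF assms] del: transpose_matrix_vector)


lemma Pmat_plus_Qmat: "Pmat g x t *v y + Qmat g x t *v (Jg g x t *v y) = y"
  by (simp add: Pmat_mult)

lemma inner_Qmat_mult:
  assumes "(x, t) \<in> regular_points g"
  shows "y \<bullet> (Qmat g x t *v z) = (Qmat g x t *v (Jg g x t *v y)) \<bullet> (Qmat g x t *v z)"
  using inner_add_left[of "Pmat g x t *v y" "Qmat g x t *v (Jg g x t *v y)" "Qmat g x t *v z"]
  unfolding Pmat_plus_Qmat Pmat_orthogonal_Qmat[OF assms] by simp

lemma inner_Pmat_mult:
  assumes "(x, t) \<in> regular_points g"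
  shows "y \<bullet> (Pmat g x t *v z) = (Pmat g x t *v y) \<bullet> (Pmat g x t *v z)"
proof -
  have "(Qmat g x t *v (Jg g x t *v y)) \<bullet> (Pmat g x t *v z) = 0"
    using Pmat_orthogonal_Qmat[OF assms] by (metis inner_commute)
  then show ?thesis
    using inner_add_left[of "Pmat g x t *v y" "Qmat g x t *v (Jg g x t *v y)" "Pmat g x t *v z"]
    unfolding Pmat_plus_Qmat by simp
qed

text \<open>Positivity of \<open>y \<bullet> (Pmat g x t *v z)\<close> forces a nonzero tangential
  part of \<open>y\<close>, so by Pythagoras the normal part is strictly shorter. For
  \<open>y\<close> the error and \<open>z\<close> the gradient, positivity comes from strong
  convexity.\<close>

lemma norm_Qmat_Jg_less:
  assumes "(x, t) \<in> regular_points g" "y \<bullet> (Pmat g x t *v z) > 0"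
  shows "norm (Qmat g x t *v (Jg g x t *v y)) < norm y"
proof -
  let ?p = "Pmat g x t *v y" and ?q = "Qmat g x t *v (Jg g x t *v y)"
  have "?p \<bullet> (Pmat g x t *v z) > 0" using assms(2) inner_Pmat_mult[OF assms(1), of y z] by linarith
  then have "?p \<noteq> 0" by auto
  have "(norm (?p + ?q))\<^sup>2 = (norm ?p)\<^sup>2 + (norm ?q)\<^sup>2"
    by (rule norm_add_Pythagorean) (simp only: orthogonal_def Pmat_orthogonal_Qmat[OF assms(1)])
  then have "(norm ?q)\<^sup>2 < (norm y)\<^sup>2" using \<open>?p \<noteq> 0\<close> unfolding Pmat_plus_Qmat by simp
  then show ?thesis by (rule power2_less_imp_less) simp
qed

section \<open>The field of the differential equation and invariance of the constraint\<close>

definition P_field ::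
  "(real^'n \<Rightarrow> real \<Rightarrow> real) \<Rightarrow> (real^'n \<Rightarrow> real \<Rightarrow> real^'m) \<Rightarrow> real \<Rightarrow> (real^'n) \<times> real \<Rightarrow> real^'n" where
  "P_field f g \<alpha> z = - ((1 / \<alpha>) *\<^sub>R (Pmat g (fst z) (snd z) *v grad (\<lambda>y. f y (snd z)) (fst z)))
     - Qmat g (fst z) (snd z) *v time_deriv (g (fst z)) (snd z)"

lemma P_ODE_solution_iff: "P_ODE_solution f g \<alpha> t0 x0 x \<longleftrightarrow> x t0 = x0 \<and>
    (\<forall>t\<ge>t0. (x has_vector_derivative P_field f g \<alpha> (x t, t)) (at t within {t0..}))"
  by (simp add: P_ODE_solution_def P_field_def)

lemma continuous_on_projected_gradient:
  assumes "smooth_problem f g"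
  shows "continuous_on (regular_points g) (\<lambda>z. Pmat g (fst z) (snd z) *v grad (\<lambda>y. f y (snd z)) (fst z))"
  using continuous_on_subset[OF continuous_grad_f[OF assms] regular_points_subset]
  unfolding case_prod_beta by (rule continuous_on_Pmat_mult[OF assms])

lemma continuous_on_P_field:
  assumes "smooth_problem f g"
  shows "continuous_on (regular_points g) (P_field f g \<alpha>)"
  unfolding P_field_def
  using continuous_on_subset[OF continuous_time_deriv_g[OF assms] regular_points_subset]
  by (intro continuous_intros continuous_on_projected_gradient[OF assms] continuous_on_Qmat_mult[OF assms])
     (simp add: case_prod_beta)

text \<open>The gradient part is tangential, and \<open>Qmat\<close> is a right inverse of the
  Jacobian, so the correction cancels the drift of the constraint exactly.\<close>

lemma Jg_P_field:
  assumes "(x, t) \<in> regular_points g"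
  shows "Jg g x t *v P_field f g \<alpha> (x, t) + time_deriv (g x) t = 0"
  by (simp add: P_field_def matrix_vector_mult_diff_distrib linear_neg[OF matrix_vector_mul_linear]
      linear_cmul[OF matrix_vector_mul_linear] Jg_Pmat[OF assms] Jg_Qmat[OF assms])

lemma P_field_feasible:
  assumes smooth: "smooth_problem f g" and "0 \<le> a" and start: "x a \<in> feasible g a" and t: "t \<in> {a..b}"
    and x: "\<And>t. t \<in> {a..b} \<Longrightarrow> (x has_vector_derivative P_field f g \<alpha> (x t, t)) (at t within {a..b})"
    and reg: "\<And>t. t \<in> {a..b} \<Longrightarrow> (x t, t) \<in> regular_points g"
  shows "x t \<in> feasible g t"
proof -
  have "((\<lambda>s. g (x s) s) has_derivative (\<lambda>h. 0)) (at t within {a..b})" if "t \<in> {a..b}" for t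
    using has_vector_derivative_along_curve[OF smooth x[OF that] that] \<open>0 \<le> a\<close> Jg_P_field[OF reg[OF that]]
    by (simp add: has_vector_derivative_def)
  then obtain c where "\<forall>s\<in>{a..b}. g (x s) s = c"
    using has_derivative_zero_constant[of "{a..b}" "\<lambda>s. g (x s) s"] by (auto simp: convex_real_interval)
  moreover have "a \<in> {a..b}" using t by auto
  ultimately show ?thesis using start t by (simp add: feasible_def)
qed

text \<open>With \<open>t\<close> frozen the constraint does not drift, so tangency of the velocity
  is all that counts; the projected vector \<open>u s\<close> is left arbitrary.\<close>

lemma frozen_gradient_flow_feasible:
  assumes smooth: "smooth_problem f g" and "0 \<le> t" and start: "\<xi> a \<in> feasible g t" and s: "s \<in> {a..b}"
    and \<xi>: "\<And>s. s \<in> {a..b} \<Longrightarrow> (\<xi> has_vector_derivative - (Pmat g (\<xi> s) t *v u s)) (at s within {a..b})"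
    and reg: "\<And>s. s \<in> {a..b} \<Longrightarrow> (\<xi> s, t) \<in> regular_points g"
  shows "\<xi> s \<in> feasible g t"
proof -
  have "((\<lambda>s. g (\<xi> s) t) has_derivative (\<lambda>h. 0)) (at s within {a..b})" if "s \<in> {a..b}" for s
  proof -
    have "((\<lambda>s. g (\<xi> s) t) has_derivative (\<lambda>h. Jg g (\<xi> s) t *v (h *\<^sub>R - (Pmat g (\<xi> s) t *v u s)))) (at s within {a..b})"
      using has_derivative_compose[OF \<xi>[OF that, unfolded has_vector_derivative_def] has_derivative_Jg[OF smooth \<open>0 \<le> t\<close>]] .
    then show ?thesis
      by (simp add: linear_neg[OF matrix_vector_mul_linear] linear_cmul[OF matrix_vector_mul_linear]
          Jg_Pmat[OF reg[OF that]])
  qed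
  then obtain c where "\<forall>s\<in>{a..b}. g (\<xi> s) t = c"
    using has_derivative_zero_constant[of "{a..b}" "\<lambda>s. g (\<xi> s) t"] by (auto simp: convex_real_interval)
  moreover have "a \<in> {a..b}" using s by auto
  ultimately show ?thesis using start s by (simp add: feasible_def)
qed

section \<open>Tracking\<close>

locale tracking_problem =
  fixes f :: "real^'n \<Rightarrow> real \<Rightarrow> real" and g :: "real^'n \<Rightarrow> real \<Rightarrow> real^'m"
    and h :: "real \<Rightarrow> real^'n" and \<alpha> t0 c r \<eta>1 \<eta>2 :: real and x0 :: "real^'n"
    and \<gamma> \<delta>1 \<delta>2 :: "real \<Rightarrow> real"
  assumes smooth: "smooth_problem f g" and full_rank: "full_row_rank g"
    and h_cont: "continuous_on {0..} h" and h_feasible: "\<And>t. t \<ge> 0 \<Longrightarrow> h t \<in> feasible g t"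
    and \<alpha>: "\<alpha> > 0" and t0: "t0 \<ge> 0" and x0: "x0 \<in> feasible g t0"
    and convex: "one_point_strongly_convex f g c r h"
    and h_der: "\<And>t. t \<ge> t0 \<Longrightarrow> h differentiable (at t within {0..})"
    and h_der_le: "\<And>t. t \<ge> t0 \<Longrightarrow> norm (time_deriv h t) \<le> \<gamma> t"
    and Q_le: "\<And>t e. t \<ge> t0 \<Longrightarrow> e + h t \<in> feasible g t \<Longrightarrow> norm e \<le> r \<Longrightarrow>
      norm (Qmat g (e + h t) t *v time_deriv (g (e + h t)) t) \<le> \<delta>1 t * norm e + \<delta>2 t"
    and \<delta>1_int: "\<And>t. t \<ge> t0 \<Longrightarrow> \<delta>1 absolutely_integrable_on {t0..t}"
    and w_int: "\<And>t. t \<ge> t0 \<Longrightarrow> (\<lambda>\<tau>. \<delta>2 \<tau> + \<gamma> \<tau>) absolutely_integrable_on {t0..t}"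
    and \<eta>1: "\<eta>1 > 0" and \<eta>2: "\<eta>2 > 0"
    and \<delta>1_le: "\<And>s t. s \<ge> t0 \<Longrightarrow> t \<ge> s \<Longrightarrow> integral {s..t} \<delta>1 \<le> \<eta>1 * (t - s) + \<eta>2"
    and w_bdd: "bdd_above ((\<lambda>t. \<delta>2 t + \<gamma> t) ` {t0..})"
    and start: "norm (x0 - h t0) \<le> r / exp \<eta>2"
    and \<alpha>_le: "\<alpha> \<le> c * r / (exp \<eta>2 * (SUP t\<in>{t0..}. \<delta>2 t + \<gamma> t) + \<eta>1 * r)"
begin

definition "w t = \<delta>2 t + \<gamma> t"
definition "S = (SUP t\<in>{t0..}. w t)"
text \<open>Net decay rate: contraction by the scaled projected gradient, less the average growth
  granted to \<delta>1. It may be 0 when \<open>S = 0\<close>, so no later estimate divides by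
  it.\<close>

definition "\<kappa> = c / \<alpha> - \<eta>1"

lemma c_pos: "c > 0" and r_pos: "r > 0"
  using convex by (auto simp: one_point_strongly_convex_def)

lemma strongly_convex:
  assumes "t \<ge> 0" "y \<in> feasible g t" "norm (y - h t) \<le> r"
  shows "(y - h t) \<bullet> (Pmat g y t *v grad (\<lambda>z. f z t) y) \<ge> c * (norm (y - h t))\<^sup>2"
proof -
  have "(y - h t) + h t \<in> feasible g t" using assms by simp
  then have "(y - h t) \<bullet> grad_Lagr f g (y - h t + h t) (multiplier f g (y - h t + h t) t) t \<ge> c * (norm (y - h t))\<^sup>2"
    using convex assms unfolding one_point_strongly_convex_def by blast
  then show ?thesis by (simp add: grad_Lagr_eq_Pmat[OF smooth \<open>t \<ge> 0\<close>])
qed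

lemma regular: "t \<ge> 0 \<Longrightarrow> y \<in> feasible g t \<Longrightarrow> (y, t) \<in> regular_points g"
  by (rule feasible_regular[OF full_rank])

lemma Q_le':
  assumes "t \<ge> t0" "y \<in> feasible g t" "norm (y - h t) \<le> r"
  shows "norm (Qmat g y t *v time_deriv (g y) t) \<le> \<delta>1 t * norm (y - h t) + \<delta>2 t"
  using Q_le[OF assms(1), of "y - h t"] assms by simp

text \<open>At error 0 the point \<open>h t\<close> is feasible and the growth bound reduces to
  \<delta>2 t alone.\<close>

lemma \<delta>2_nonneg: "t \<ge> t0 \<Longrightarrow> \<delta>2 t \<ge> 0"
proof -
  assume "t \<ge> t0"
  then have "norm (Qmat g (h t) t *v time_deriv (g (h t)) t) \<le> \<delta>1 t * norm (h t - h t) + \<delta>2 t"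
    using t0 r_pos by (intro Q_le' h_feasible) auto
  from order_trans[OF norm_ge_zero this] show "\<delta>2 t \<ge> 0" by simp
qed

lemma \<gamma>_nonneg: "t \<ge> t0 \<Longrightarrow> \<gamma> t \<ge> 0"
  using h_der_le[of t] norm_ge_zero[of "time_deriv h t"] by linarith

lemma w_nonneg: "t \<ge> t0 \<Longrightarrow> w t \<ge> 0"
  using \<delta>2_nonneg \<gamma>_nonneg by (simp add: w_def)

lemma w_le: "t \<ge> t0 \<Longrightarrow> w t \<le> S"
  unfolding S_def using w_bdd by (intro cSUP_upper) (auto simp: w_def)

lemma S_nonneg: "S \<ge> 0"
  using w_nonneg[of t0] w_le[of t0] by simp

text \<open>The condition on \<alpha> with its denominator cleared, which is positive because
  \<eta>1 * r is.\<close>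

lemma S_le: "exp \<eta>2 * S \<le> \<kappa> * r"
proof -
  have D: "exp \<eta>2 * S + \<eta>1 * r > 0" using S_nonneg \<eta>1 r_pos by (intro add_nonneg_pos) auto
  have "\<alpha> * (exp \<eta>2 * S + \<eta>1 * r) \<le> c * r"
    using \<alpha>_le D by (simp add: S_def w_def pos_le_divide_eq)
  then have "exp \<eta>2 * S + \<eta>1 * r \<le> c * r / \<alpha>" using \<alpha> by (simp add: pos_le_divide_eq mult.commute)
  then show ?thesis by (simp add: \<kappa>_def algebra_simps)
qed

lemma \<kappa>_nonneg: "\<kappa> \<ge> 0"
proof -
  have "0 \<le> \<kappa> * r" using S_le S_nonneg by (meson exp_ge_zero mult_nonneg_nonneg order_trans)
  then show ?thesis using r_pos by (simp add: zero_le_mult_iff)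
qed

lemma w_absolutely_integrable: "t0 \<le> s \<Longrightarrow> w absolutely_integrable_on {s..t}"
proof (cases "s \<le> t")
  case True
  assume "t0 \<le> s"
  with True have "(\<lambda>\<tau>. \<delta>2 \<tau> + \<gamma> \<tau>) absolutely_integrable_on {s..t}"
    by (intro absolutely_integrable_on_subinterval[OF w_int[of t]]) auto
  then show ?thesis by (simp add: w_def[abs_def])
qed auto

lemma \<delta>1_absolutely_integrable: "t0 \<le> s \<Longrightarrow> \<delta>1 absolutely_integrable_on {s..t}"
proof (cases "s \<le> t")
  case True
  assume "t0 \<le> s"
  with True show ?thesis
    by (intro absolutely_integrable_on_subinterval[OF \<delta>1_int[of t]]) auto
qed auto

text \<open>The factor \<open>a\<close> is 1 in the main estimate and a ratio below 1 in the case
  without source.\<close>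

lemma rate_absolutely_integrable:
  "t0 \<le> s \<Longrightarrow> (\<lambda>\<tau>. a * \<delta>1 \<tau> - b) absolutely_integrable_on {s..t}"
proof -
  assume "t0 \<le> s"
  have "(\<lambda>\<tau>. a * \<delta>1 \<tau>) absolutely_integrable_on {s..t}"
    by (intro set_integrable_mult_right \<delta>1_absolutely_integrable \<open>t0 \<le> s\<close>)
  moreover have "(\<lambda>\<tau>. b) absolutely_integrable_on {s..t}"
    by (rule absolutely_integrable_continuous_real) simp
  ultimately show "(\<lambda>\<tau>. a * \<delta>1 \<tau> - b) absolutely_integrable_on {s..t}" by (rule set_integral_diff)
qed

lemma integral_rate:
  assumes "t0 \<le> s" "s \<le> t"
  shows "integral {s..t} (\<lambda>\<tau>. a * \<delta>1 \<tau> - b) = a * integral {s..t} \<delta>1 - b * (t - s)"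
proof -
  have "\<delta>1 integrable_on {s..t}"
    using \<delta>1_absolutely_integrable[OF assms(1)] by (auto simp: absolutely_integrable_on_def)
  then show ?thesis using assms by (subst integral_diff) (auto intro: integrable_on_mult_right)
qed

text \<open>Bounds the propagator from \<open>s\<close> to \<open>t\<close>. It is applied at every
  release time \<open>s\<close> of the source, which is why the integral of \<delta>1 has to be
  controlled on all subintervals.\<close>

lemma exp_rate_le:
  assumes "t0 \<le> s" "s \<le> t"
  shows "exp (integral {s..t} (\<lambda>\<tau>. 1 * \<delta>1 \<tau> - c / \<alpha>)) \<le> exp \<eta>2 * exp (- \<kappa> * (t - s))"
proof -
  have "integral {s..t} (\<lambda>\<tau>. 1 * \<delta>1 \<tau> - c / \<alpha>) \<le> \<eta>2 + - \<kappa> * (t - s)"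
    unfolding integral_rate[OF assms] using \<delta>1_le[OF assms] by (simp add: \<kappa>_def algebra_simps)
  then show ?thesis by (simp add: mult_exp_exp)
qed

lemma start_less: "norm (x0 - h t0) < r"
proof -
  have "r / exp \<eta>2 < r / 1" using r_pos \<eta>2 by (intro divide_strict_left_mono) auto
  with start show ?thesis by simp
qed

definition "bound t = exp \<eta>2 * norm (x0 - h t0) * exp (- \<kappa> * (t - t0))
  + exp \<eta>2 * integral {t0..t} (\<lambda>\<tau>. exp (- \<kappa> * (t - \<tau>)) * w \<tau>)"

lemma kernel_integrable:
  assumes "t0 \<le> s"
  shows "(\<lambda>\<tau>. exp (- \<kappa> * (t - \<tau>)) * w \<tau>) integrable_on {s..t}"
proof -
  have "(\<lambda>\<tau>. exp (- \<kappa> * (t - \<tau>)) * w \<tau>) absolutely_integrable_on {s..t}"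
    by (rule continuous_mult_absolutely_integrable[OF _ w_absolutely_integrable[OF assms]])
       (auto intro!: continuous_intros)
  then show ?thesis by (auto simp: absolutely_integrable_on_def)
qed

text \<open>Kept in product form so that it remains valid for \<kappa> = 0.\<close>

lemma integral_kernel: "s \<le> t \<Longrightarrow> \<kappa> * integral {s..t} (\<lambda>\<tau>. exp (- \<kappa> * (t - \<tau>))) = 1 - exp (- \<kappa> * (t - s))"
proof -
  assume "s \<le> t"
  then have "((\<lambda>\<tau>. \<kappa> * exp (- \<kappa> * (t - \<tau>))) has_integral exp (- \<kappa> * (t - t)) - exp (- \<kappa> * (t - s))) {s..t}"
    by (intro fundamental_theorem_of_calculus)
       (auto intro!: derivative_eq_intros simp flip: has_real_derivative_iff_has_vector_derivative)
  from integral_unique[OF this] show ?thesis by simp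
qed

lemma start_term_le: "exp \<eta>2 * norm (x0 - h t0) * exp (- \<kappa> * (t - t0)) \<le> r * exp (- \<kappa> * (t - t0))"
  using start by (intro mult_right_mono) (auto simp: pos_le_divide_eq mult.commute)

text \<open>\<open>S_le\<close> is used before the kernel is integrated, which supplies the factor
  \<kappa> needed there. The result complements \<open>start_term_le\<close>: the two right-hand
  sides sum to \<open>r\<close>.\<close>

lemma source_term_le:
  assumes "t0 \<le> t"
  shows "exp \<eta>2 * S * integral {t0..t} (\<lambda>\<tau>. exp (- \<kappa> * (t - \<tau>))) \<le> r * (1 - exp (- \<kappa> * (t - t0)))"
proof -
  have "0 \<le> integral {t0..t} (\<lambda>\<tau>. exp (- \<kappa> * (t - \<tau>)))"
    by (intro integral_nonneg integrable_continuous_real) (auto intro!: continuous_intros)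
  from mult_right_mono[OF S_le this] have "exp \<eta>2 * S * integral {t0..t} (\<lambda>\<tau>. exp (- \<kappa> * (t - \<tau>)))
      \<le> r * (\<kappa> * integral {t0..t} (\<lambda>\<tau>. exp (- \<kappa> * (t - \<tau>))))" by (simp add: mult_ac)
  then show ?thesis unfolding integral_kernel[OF assms] .
qed

lemma bound_le:
  assumes "t0 \<le> t"
  shows "bound t \<le> r"
proof -
  have "integral {t0..t} (\<lambda>\<tau>. exp (- \<kappa> * (t - \<tau>)) * w \<tau>) \<le> integral {t0..t} (\<lambda>\<tau>. exp (- \<kappa> * (t - \<tau>)) * S)"
    using w_le by (intro integral_le kernel_integrable mult_left_mono integrable_continuous_real)
      (auto intro!: continuous_intros)
  then have "exp \<eta>2 * integral {t0..t} (\<lambda>\<tau>. exp (- \<kappa> * (t - \<tau>)) * w \<tau>)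
      \<le> exp \<eta>2 * (integral {t0..t} (\<lambda>\<tau>. exp (- \<kappa> * (t - \<tau>))) * S)"
    by (intro mult_left_mono) auto
  also have "\<dots> = exp \<eta>2 * S * integral {t0..t} (\<lambda>\<tau>. exp (- \<kappa> * (t - \<tau>)))" by (simp only: mult_ac)
  also note source_term_le[OF assms]
  finally show ?thesis using start_term_le[of t] unfolding bound_def right_diff_distrib by linarith
qed

section \<open>Error estimates for a feasible solution on a bounded interval\<close>

context
  fixes x :: "real \<Rightarrow> real^'n" and T :: real
  assumes T: "t0 \<le> T" and x_start: "x t0 = x0"
    and x_der: "\<And>t. t \<in> {t0..T} \<Longrightarrow> (x has_vector_derivative P_field f g \<alpha> (x t, t)) (at t within {t0..T})"
    and x_feasible: "\<And>t. t \<in> {t0..T} \<Longrightarrow> x t \<in> feasible g t"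
begin

lemma h_der_within:
  assumes "t \<in> {t0..T}"
  shows "(h has_vector_derivative time_deriv h t) (at t within {t0..T})"
  by (rule has_vector_derivative_within_subset[OF has_vector_derivative_time_deriv[OF h_der]])
     (use assms t0 in auto)

lemma e_der:
  assumes "t \<in> {t0..T}"
  shows "((\<lambda>t. x t - h t) has_vector_derivative P_field f g \<alpha> (x t, t) - time_deriv h t) (at t within {t0..T})"
  by (intro has_vector_derivative_diff x_der h_der_within assms)

lemma continuous_x: "continuous_on {t0..T} x"
  using x_der by (meson continuous_on_eq_continuous_within has_vector_derivative_continuous)

lemma continuous_e: "continuous_on {t0..T} (\<lambda>t. x t - h t)"
  using e_der by (meson continuous_on_eq_continuous_within has_vector_derivative_continuous)

text \<open>The \<open>Qmat\<close> term is deliberately left standing: it is estimated later in two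
  ways, against the whole error in general and against the normal part of the error when there is no
  source.\<close>

lemma inner_e_der:
  assumes "t \<in> {t0..T}" and ball: "norm (x t - h t) \<le> r"
  shows "(x t - h t) \<bullet> (P_field f g \<alpha> (x t, t) - time_deriv h t) \<le>
    - (c / \<alpha>) * (norm (x t - h t))\<^sup>2 - (x t - h t) \<bullet> (Qmat g (x t) t *v time_deriv (g (x t)) t)
    + norm (x t - h t) * \<gamma> t"
proof -
  have t: "t \<ge> 0" "t \<ge> t0" using assms t0 by auto
  let ?e = "x t - h t"
  have "(1 / \<alpha>) * (c * (norm ?e)\<^sup>2) \<le> (1 / \<alpha>) * (?e \<bullet> (Pmat g (x t) t *v grad (\<lambda>z. f z t) (x t)))"
    using strongly_convex[OF t(1) x_feasible[OF assms(1)] ball] \<alpha> by (intro mult_left_mono) auto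
  moreover have "- (?e \<bullet> time_deriv h t) \<le> norm ?e * \<gamma> t"
  proof -
    have "- (?e \<bullet> time_deriv h t) \<le> norm ?e * norm (time_deriv h t)"
      using Cauchy_Schwarz_ineq2[of ?e "time_deriv h t"] by linarith
    also have "\<dots> \<le> norm ?e * \<gamma> t" using h_der_le[OF t(2)] by (intro mult_left_mono) auto
    finally show ?thesis .
  qed
  ultimately show ?thesis by (simp add: P_field_def inner_diff_right)
qed

text \<open>The start \<open>s\<close> is free because, besides \<open>t0\<close>, a time at which
  the error vanishes is needed. The factor 1 keeps the shape of
  \<open>integral_rate\<close>.\<close>

lemma error_le_from:
  assumes ball: "\<And>t. t \<in> {t0..T} \<Longrightarrow> norm (x t - h t) \<le> r" and s: "s \<in> {t0..T}"
  shows "norm (x T - h T) \<le> exp (integral {s..T} (\<lambda>\<tau>. 1 * \<delta>1 \<tau> - c / \<alpha>)) * norm (x s - h s)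
    + integral {s..T} (\<lambda>\<sigma>. exp (integral {\<sigma>..T} (\<lambda>\<tau>. 1 * \<delta>1 \<tau> - c / \<alpha>)) * w \<sigma>)"
proof (rule gronwall_norm[where e' = "\<lambda>t. P_field f g \<alpha> (x t, t) - time_deriv h t"])
  show "s \<le> T" using s by simp
  show "(\<lambda>\<tau>. 1 * \<delta>1 \<tau> - c / \<alpha>) absolutely_integrable_on {s..T}" "w absolutely_integrable_on {s..T}"
    using s by (auto intro!: w_absolutely_integrable rate_absolutely_integrable[where a = 1, simplified])
  fix t assume "t \<in> {s..T}"
  then have t: "t \<in> {t0..T}" using s by auto
  then show "0 \<le> w t" by (intro w_nonneg) auto
  show "((\<lambda>t. x t - h t) has_vector_derivative P_field f g \<alpha> (x t, t) - time_deriv h t) (at t within {s..T})"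
    using s by (intro has_vector_derivative_within_subset[OF e_der[OF t]]) auto
  let ?e = "x t - h t" and ?q = "Qmat g (x t) t *v time_deriv (g (x t)) t"
  have "- (?e \<bullet> ?q) \<le> norm ?e * norm ?q" using Cauchy_Schwarz_ineq2[of ?e ?q] by linarith
  also have "\<dots> \<le> norm ?e * (\<delta>1 t * norm ?e + \<delta>2 t)"
    using Q_le'[OF _ x_feasible[OF t] ball[OF t]] t by (intro mult_left_mono) auto
  finally show "?e \<bullet> (P_field f g \<alpha> (x t, t) - time_deriv h t) \<le> (norm ?e * (1 * \<delta>1 t - c / \<alpha>) + w t) * norm ?e"
    using inner_e_der[OF t ball[OF t]] by (simp add: w_def algebra_simps power2_eq_square)
qed

lemma error_le_bound:
  assumes ball: "\<And>t. t \<in> {t0..T} \<Longrightarrow> norm (x t - h t) \<le> r"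
  shows "norm (x T - h T) \<le> bound T"
proof -
  define E where "E \<sigma> = exp (integral {\<sigma>..T} (\<lambda>\<tau>. 1 * \<delta>1 \<tau> - c / \<alpha>))" for \<sigma>
  have k: "(\<lambda>\<tau>. 1 * \<delta>1 \<tau> - c / \<alpha>) integrable_on {t0..T}"
    using rate_absolutely_integrable[where a = 1 and s = t0 and b = "c / \<alpha>" and t = T] by (auto simp: absolutely_integrable_on_def)
  have "continuous_on {t0..T} E" unfolding E_def
    by (intro continuous_intros indefinite_integral_continuous_1'[OF k])
  then have Ew: "(\<lambda>\<sigma>. E \<sigma> * w \<sigma>) integrable_on {t0..T}"
    using continuous_mult_absolutely_integrable[OF _ w_absolutely_integrable[of t0 T]]
    by (auto simp: absolutely_integrable_on_def)
  have "norm (x T - h T) \<le> E t0 * norm (x0 - h t0) + integral {t0..T} (\<lambda>\<sigma>. E \<sigma> * w \<sigma>)"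
    using error_le_from[OF ball, of t0] T by (simp add: E_def x_start)
  also have "E t0 * norm (x0 - h t0) \<le> exp \<eta>2 * exp (- \<kappa> * (T - t0)) * norm (x0 - h t0)"
    unfolding E_def using T by (intro mult_right_mono exp_rate_le) auto
  also have "integral {t0..T} (\<lambda>\<sigma>. E \<sigma> * w \<sigma>) \<le> integral {t0..T} (\<lambda>\<sigma>. exp \<eta>2 * (exp (- \<kappa> * (T - \<sigma>)) * w \<sigma>))"
  proof (rule integral_le[OF Ew])
    show "(\<lambda>\<sigma>. exp \<eta>2 * (exp (- \<kappa> * (T - \<sigma>)) * w \<sigma>)) integrable_on {t0..T}"
      by (intro integrable_on_mult_right kernel_integrable) simp
    fix \<sigma> assume "\<sigma> \<in> {t0..T}"
    then show "E \<sigma> * w \<sigma> \<le> exp \<eta>2 * (exp (- \<kappa> * (T - \<sigma>)) * w \<sigma>)"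
      using mult_right_mono[OF exp_rate_le[of \<sigma> T] w_nonneg[of \<sigma>]] by (simp add: E_def mult.assoc)
  qed
  finally show ?thesis by (simp add: bound_def algebra_simps)
qed

text \<open>The true propagator \<open>E\<close> and its majorant \<open>B\<close> differ at the
  final time, where \<open>E T = 1 < exp \<eta>2 = B T\<close>. Since both are continuous and
  \<open>E \<le> B\<close>, their integrals differ strictly.\<close>

lemma error_less_positive_source:
  assumes ball: "\<And>t. t \<in> {t0..T} \<Longrightarrow> norm (x t - h t) \<le> r" and "t0 < T" "S > 0"
  shows "norm (x T - h T) < r"
proof -
  define E where "E \<sigma> = exp (integral {\<sigma>..T} (\<lambda>\<tau>. 1 * \<delta>1 \<tau> - c / \<alpha>))" for \<sigma>
  have k: "(\<lambda>\<tau>. 1 * \<delta>1 \<tau> - c / \<alpha>) integrable_on {t0..T}"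
    using rate_absolutely_integrable[where a = 1 and s = t0 and b = "c / \<alpha>" and t = T] by (auto simp: absolutely_integrable_on_def)
  have contE: "continuous_on {t0..T} E" unfolding E_def
    by (intro continuous_intros indefinite_integral_continuous_1'[OF k])
  then have Ew: "(\<lambda>\<sigma>. E \<sigma> * w \<sigma>) integrable_on {t0..T}"
    using continuous_mult_absolutely_integrable[OF _ w_absolutely_integrable[of t0 T]]
    by (auto simp: absolutely_integrable_on_def)
  define B where "B \<sigma> = exp \<eta>2 * exp (- \<kappa> * (T - \<sigma>))" for \<sigma>
  have contB: "continuous_on {t0..T} B" unfolding B_def by (intro continuous_intros)
  have contBE: "continuous_on {t0..T} (\<lambda>\<sigma>. B \<sigma> - E \<sigma>)" by (intro continuous_intros contB contE)
  have EB: "E \<sigma> \<le> B \<sigma>" if "\<sigma> \<in> {t0..T}" for \<sigma> unfolding E_def B_def using that by (intro exp_rate_le) auto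
  have "E T < B T" using \<eta>2 by (simp add: E_def B_def)
  then have "integral {t0..T} (\<lambda>\<sigma>. B \<sigma> - E \<sigma>) \<noteq> 0"
    using integral_eq_0_iff[OF contBE \<open>t0 < T\<close>] EB T by force
  moreover have "integral {t0..T} (\<lambda>\<sigma>. B \<sigma> - E \<sigma>) \<ge> 0"
    using EB by (intro integral_nonneg integrable_continuous_real contBE) simp
  moreover have "integral {t0..T} (\<lambda>\<sigma>. B \<sigma> - E \<sigma>) = integral {t0..T} B - integral {t0..T} E"
    by (intro integral_diff integrable_continuous_real contB contE)
  ultimately have less: "integral {t0..T} E < integral {t0..T} B" by linarith
  have "norm (x T - h T) \<le> E t0 * norm (x0 - h t0) + integral {t0..T} (\<lambda>\<sigma>. E \<sigma> * w \<sigma>)"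
    using error_le_from[OF ball, of t0] T by (simp add: E_def x_start)
  also have "E t0 * norm (x0 - h t0) \<le> B t0 * norm (x0 - h t0)"
    using EB[of t0] T by (intro mult_right_mono) auto
  \<comment> \<open>\<open>w\<close> is replaced by \<open>S\<close> before \<open>E\<close> by
    \<open>B\<close>; in the opposite order the gap would be lost wherever \<open>w\<close>
    vanishes.\<close>
  also have "integral {t0..T} (\<lambda>\<sigma>. E \<sigma> * w \<sigma>) \<le> integral {t0..T} (\<lambda>\<sigma>. E \<sigma> * S)"
    by (intro integral_le Ew integrable_continuous_real mult_left_mono w_le continuous_intros contE)
       (auto simp: E_def)
  also have "\<dots> < S * integral {t0..T} B" using less \<open>S > 0\<close> by (simp add: mult.commute)
  also have "B t0 * norm (x0 - h t0) + S * integral {t0..T} B \<le> r"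
  proof -
    have "S * integral {t0..T} B = exp \<eta>2 * S * integral {t0..T} (\<lambda>\<tau>. exp (- \<kappa> * (T - \<tau>)))"
      by (simp add: B_def[abs_def])
    moreover have "B t0 * norm (x0 - h t0) = exp \<eta>2 * norm (x0 - h t0) * exp (- \<kappa> * (T - t0))"
      by (simp add: B_def)
    ultimately show ?thesis
      using start_term_le[of T] source_term_le[OF T] unfolding right_diff_distrib[of r] by linarith
  qed
  finally show ?thesis by simp
qed

text \<open>Without source term the bound \<open>r\<close> of the estimate could be attained at \<open>T\<close>. This is excluded
  by the geometry: \<open>Q g'\<close> only pairs with the component of the error normal to the feasible set,
  and one-point strong convexity forces a nonzero tangential component.\<close>

lemma error_less_zero_source:
  assumes ball: "\<And>t. t \<in> {t0..T} \<Longrightarrow> norm (x t - h t) \<le> r" and "t0 < T" "S = 0"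
  shows "norm (x T - h T) < r"
proof -
  have w0: "w t = 0" if "t \<ge> t0" for t using w_nonneg[OF that] w_le[OF that] \<open>S = 0\<close> by simp
  have \<delta>\<gamma>0: "\<delta>2 t = 0" "\<gamma> t = 0" if "t \<ge> t0" for t
    using w0[OF that] \<delta>2_nonneg[OF that] \<gamma>_nonneg[OF that] by (auto simp: w_def)
  show ?thesis
  \<comment> \<open>From a zero of the error on, the estimate has neither initial nor source term,
    so the error at \<open>T\<close> is 0. Otherwise the ratio of normal part to error is defined
    throughout.\<close>
  proof (cases "\<exists>s\<in>{t0..T}. x s = h s")
    case True
    then obtain s where s: "s \<in> {t0..T}" "x s = h s" by blast
    have "integral {s..T} (\<lambda>\<sigma>. exp (integral {\<sigma>..T} (\<lambda>\<tau>. 1 * \<delta>1 \<tau> - c / \<alpha>)) * w \<sigma>) = integral {s..T} (\<lambda>_. 0)"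
      using s w0 by (intro integral_cong) auto
    then show ?thesis using error_le_from[OF ball s(1)] s(2) r_pos by simp
  next
    case False
    define N where "N t = Qmat g (x t) t *v (Jg g (x t) t *v (x t - h t))" for t
    have pos: "norm (x t - h t) > 0" if "t \<in> {t0..T}" for t using False that by auto
    have reg: "(x t, t) \<in> regular_points g" if "t \<in> {t0..T}" for t
      using that t0 by (intro regular x_feasible) auto
    have Nless: "norm (N t) < norm (x t - h t)" if t: "t \<in> {t0..T}" for t
      unfolding N_def
    proof (rule norm_Qmat_Jg_less[OF reg[OF t]])
      have "0 < c * (norm (x t - h t))\<^sup>2" using pos[OF t] c_pos by simp
      also have "\<dots> \<le> (x t - h t) \<bullet> (Pmat g (x t) t *v grad (\<lambda>z. f z t) (x t))"
        using t t0 by (intro strongly_convex x_feasible ball) auto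
      finally show "0 < (x t - h t) \<bullet> (Pmat g (x t) t *v grad (\<lambda>z. f z t) (x t))" .
    qed
    have "continuous_on (regular_points g) (\<lambda>z. Qmat g (fst z) (snd z) *v (Jg g (fst z) (snd z) *v (fst z - h (snd z))))"
      using continuous_on_subset[OF continuous_Jg[OF smooth] regular_points_subset]
      by (intro continuous_on_Qmat_mult[OF smooth] continuous_on_matrix_vector_mult continuous_intros
          continuous_on_compose2[OF h_cont]) (auto simp: case_prod_beta regular_points_def)
    moreover have "continuous_on {t0..T} (\<lambda>t. (x t, t))" by (intro continuous_intros continuous_x)
    moreover have "(\<lambda>t. (x t, t)) ` {t0..T} \<subseteq> regular_points g" using reg by auto
    ultimately have "continuous_on {t0..T} (\<lambda>t. Qmat g (fst (x t, t)) (snd (x t, t)) *v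
        (Jg g (fst (x t, t)) (snd (x t, t)) *v (fst (x t, t) - h (snd (x t, t)))))"
      by (rule continuous_on_compose2)
    then have contN: "continuous_on {t0..T} N" by (simp add: N_def[abs_def])
    have "continuous_on {t0..T} (\<lambda>t. norm (N t) / norm (x t - h t))"
      using False by (intro continuous_intros contN continuous_e) auto
    from continuous_attains_sup[OF compact_Icc _ this] T
    obtain t1 where t1: "t1 \<in> {t0..T}"
      and max: "\<And>t. t \<in> {t0..T} \<Longrightarrow> norm (N t) / norm (x t - h t) \<le> norm (N t1) / norm (x t1 - h t1)"
      by auto
    \<comment> \<open>The maximum over a compact interval turns the pointwise strict inequality
      \<open>Nless\<close> into a single factor below 1, which multiplies \<delta>1 in the Gronwall
      estimate.\<close>
    define \<theta> where "\<theta> = norm (N t1) / norm (x t1 - h t1)"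
    have \<theta>: "0 \<le> \<theta>" "\<theta> < 1" using Nless[OF t1] pos[OF t1] by (auto simp: \<theta>_def)
    have N\<theta>: "norm (N t) \<le> \<theta> * norm (x t - h t)" if "t \<in> {t0..T}" for t
      using max[OF that] pos[OF that] unfolding \<theta>_def[symmetric] by (simp add: pos_divide_le_eq)
    have "norm (x T - h T) \<le> exp (integral {t0..T} (\<lambda>\<tau>. \<theta> * \<delta>1 \<tau> - c / \<alpha>)) * norm (x t0 - h t0)
      + integral {t0..T} (\<lambda>\<sigma>. exp (integral {\<sigma>..T} (\<lambda>\<tau>. \<theta> * \<delta>1 \<tau> - c / \<alpha>)) * 0)"
    proof (rule gronwall_norm[where w = "\<lambda>_. 0" and e' = "\<lambda>t. P_field f g \<alpha> (x t, t) - time_deriv h t"])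
      show "(\<lambda>\<tau>. \<theta> * \<delta>1 \<tau> - c / \<alpha>) absolutely_integrable_on {t0..T}"
        by (rule rate_absolutely_integrable) simp
      fix t assume t: "t \<in> {t0..T}"
      let ?e = "x t - h t" and ?q = "Qmat g (x t) t *v time_deriv (g (x t)) t"
      have "- (?e \<bullet> ?q) = - (N t \<bullet> ?q)" unfolding N_def using inner_Qmat_mult[OF reg[OF t]] by simp
      also have "\<dots> \<le> norm (N t) * norm ?q" using Cauchy_Schwarz_ineq2[of "N t" ?q] by linarith
      also have "\<dots> \<le> (\<theta> * norm ?e) * (\<delta>1 t * norm ?e)"
        using N\<theta>[OF t] Q_le'[OF _ x_feasible[OF t] ball[OF t]] \<delta>\<gamma>0[of t] t \<theta>
        by (intro mult_mono) auto
      finally show "?e \<bullet> (P_field f g \<alpha> (x t, t) - time_deriv h t) \<le> (norm ?e * (\<theta> * \<delta>1 t - c / \<alpha>) + 0) * norm ?e"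
        using inner_e_der[OF t ball[OF t]] \<delta>\<gamma>0[of t] t by (simp add: algebra_simps power2_eq_square)
    qed (use T in \<open>auto intro: e_der\<close>)
    then have "norm (x T - h T) \<le> exp (\<theta> * integral {t0..T} \<delta>1 - c / \<alpha> * (T - t0)) * norm (x0 - h t0)"
      using T by (simp add: integral_rate x_start)
    also have "\<dots> < exp \<eta>2 * norm (x0 - h t0)"
    proof (rule mult_strict_right_mono)
      show "0 < norm (x0 - h t0)" using pos[of t0] T x_start by simp
      let ?\<Delta> = "integral {t0..T} \<delta>1"
      have \<Delta>: "?\<Delta> \<le> c / \<alpha> * (T - t0) + \<eta>2"
      proof -
        have "\<eta>1 * (T - t0) \<le> c / \<alpha> * (T - t0)"
          using \<kappa>_nonneg T by (intro mult_right_mono) (auto simp: \<kappa>_def)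
        then show ?thesis using \<delta>1_le[OF order_refl T] by linarith
      qed
      have "0 \<le> c / \<alpha> * (T - t0)" using c_pos \<alpha> T by simp
      \<comment> \<open>For a positive integral of \<delta>1 the factor \<theta> < 1 gives the
        strict inequality; otherwise \<eta>2 > 0 does.\<close>
      moreover have "\<theta> * ?\<Delta> < ?\<Delta> \<or> \<theta> * ?\<Delta> \<le> 0"
        using \<theta> mult_nonneg_nonpos[OF \<theta>(1), of ?\<Delta>] by (cases "?\<Delta> > 0") auto
      ultimately have "\<theta> * ?\<Delta> - c / \<alpha> * (T - t0) < \<eta>2" using \<Delta> \<eta>2 by linarith
      then show "exp (\<theta> * ?\<Delta> - c / \<alpha> * (T - t0)) < exp \<eta>2" by (rule exp_less_mono)
    qed
    also have "\<dots> \<le> r" using start by (simp add: pos_le_divide_eq mult.commute)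
    finally show ?thesis .
  qed
qed

lemma error_less:
  assumes ball: "\<And>t. t \<in> {t0..T} \<Longrightarrow> norm (x t - h t) \<le> r"
  shows "norm (x T - h T) < r"
proof (cases "t0 < T")
  case True
  then show ?thesis
    using error_less_positive_source[OF ball True] error_less_zero_source[OF ball True] S_nonneg by fastforce
next
  case False
  then show ?thesis using T start_less x_start by simp
qed

end

text \<open>Discharges the assumption that the curve stays in the ball: \<open>error_less\<close>,
  applied on every initial piece, is the step of the barrier argument.\<close>

lemma error_less_radius:
  assumes x_start: "x t0 = x0"
    and x_der: "\<And>t. t \<in> {t0..T} \<Longrightarrow> (x has_vector_derivative P_field f g \<alpha> (x t, t)) (at t within {t0..T})"
    and x_feasible: "\<And>t. t \<in> {t0..T} \<Longrightarrow> x t \<in> feasible g t"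
    and t: "t \<in> {t0..T}"
  shows "norm (x t - h t) < r"
proof (rule barrier[of t0 T "\<lambda>t. norm (x t - h t)", OF _ _ _ t])
  have T: "t0 \<le> T" using t by auto
  show "continuous_on {t0..T} (\<lambda>t. norm (x t - h t))"
    by (intro continuous_on_norm continuous_e[OF T x_start x_der x_feasible])
  show "norm (x t0 - h t0) < r" using start_less x_start by simp
  fix \<tau> assume \<tau>: "\<tau> \<in> {t0..T}" and le: "\<And>s. s \<in> {t0..\<tau>} \<Longrightarrow> norm (x s - h s) \<le> r"
  show "norm (x \<tau> - h \<tau>) < r"
  proof (rule error_less[OF _ x_start _ _ le])
    show "t0 \<le> \<tau>" using \<tau> by simp
    show "(x has_vector_derivative P_field f g \<alpha> (x t, t)) (at t within {t0..\<tau>})" if "t \<in> {t0..\<tau>}" for t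
      using that \<tau> by (intro has_vector_derivative_within_subset[OF x_der]) auto
    show "x t \<in> feasible g t" if "t \<in> {t0..\<tau>}" for t using that \<tau> by (intro x_feasible) auto
  qed
qed


section \<open>Feasibility and existence of solutions\<close>

text \<open>Outside the feasible set \<open>matrix_inv\<close> may be junk, so regularity along a solution has to be
  shown together with feasibility: at a first singular time the curve would still be feasible.\<close>

lemma P_ODE_feasible:
  assumes x_start: "x t0 = x0"
    and x_der: "\<And>t. t \<ge> t0 \<Longrightarrow> (x has_vector_derivative P_field f g \<alpha> (x t, t)) (at t within {t0..})"
    and "t \<ge> t0"
  shows "x t \<in> feasible g t"
proof -
  have der: "(x has_vector_derivative P_field f g \<alpha> (x s, s)) (at s within {t0..b})" if "s \<in> {t0..b}" for s b
    using that by (intro has_vector_derivative_within_subset[OF x_der]) auto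
  have contx: "continuous_on {t0..b} x" for b
    using der by (meson continuous_on_eq_continuous_within has_vector_derivative_continuous)
  define singular where "singular = {t0..t} \<inter> (\<lambda>s. det (Jg g (x s) s ** transpose (Jg g (x s) s))) -` {0}"
  have reg_iff: "(x s, s) \<in> regular_points g \<longleftrightarrow> s \<notin> singular" if "s \<in> {t0..t}" for s
    using that t0 by (auto simp: singular_def regular_points_def)
  have J: "continuous_on {t0..t} (\<lambda>s. Jg g (x s) s)"
  proof -
    have pair: "continuous_on {t0..t} (\<lambda>s. (x s, s))" by (intro continuous_intros contx)
    have sub: "(\<lambda>s. (x s, s)) ` {t0..t} \<subseteq> UNIV \<times> {0..}" using t0 by auto
    from continuous_on_compose2[OF continuous_Jg[OF smooth] pair sub] show ?thesis by simp
  qed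
  have "closed singular" unfolding singular_def
    by (intro continuous_closed_preimage continuous_on_det continuous_on_matrix_mult continuous_on_transpose J) auto
  have nonsing: "s \<notin> singular" if s: "s \<in> {t0..t}" for s
  proof (rule no_first_time[OF \<open>closed singular\<close> _ s])
    fix \<tau> assume \<tau>: "\<tau> \<in> {t0..t}" and before: "\<And>s. s \<in> {t0..<\<tau>} \<Longrightarrow> s \<notin> singular"
    have feas: "x s \<in> feasible g s" if "s \<in> {t0..<\<tau>}" for s
    proof (rule P_field_feasible[OF smooth t0, of x s s])
      show "(x s', s') \<in> regular_points g" if "s' \<in> {t0..s}" for s'
        using reg_iff[of s'] before[of s'] that \<open>s \<in> {t0..<\<tau>}\<close> \<tau> by auto
    qed (use that x_start x0 der in auto)
    \<comment> \<open>The chain rule along the curve needs no regularity, so the constraint value is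
      continuous up to \<tau>; vanishing before \<tau>, it vanishes at \<tau>.\<close>
    have "x \<tau> \<in> feasible g \<tau>"
    proof (cases "t0 < \<tau>")
      case True
      have "continuous_on {t0..\<tau>} (\<lambda>s. g (x s) s)"
      proof -
        have "{t0..\<tau>} \<subseteq> {0..}" using t0 by auto
        from has_vector_derivative_continuous[OF has_vector_derivative_along_curve[OF smooth der _ this]]
        show ?thesis unfolding continuous_on_eq_continuous_within by blast
      qed
      then have cont: "continuous_on (closure {t0..<\<tau>}) (\<lambda>s. g (x s) s)" using True by simp
      have zero: "g (x s) s = 0" if "s \<in> {t0..<\<tau>}" for s using feas[OF that] by (simp add: feasible_def)
      have "\<tau> \<in> closure {t0..<\<tau>}" using True by simp
      from continuous_constant_on_closure[OF cont zero this] have "g (x \<tau>) \<tau> = 0" .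
      then show ?thesis by (simp add: feasible_def)
    next
      case False
      then show ?thesis using \<tau> x_start x0 by auto
    qed
    then show "\<tau> \<notin> singular" using regular[of \<tau> "x \<tau>"] \<tau> t0 reg_iff[OF \<tau>] by auto
  qed
  show ?thesis
    by (rule P_field_feasible[OF smooth t0, of x t t]) (use x_start x0 der reg_iff nonsing \<open>t \<ge> t0\<close> in auto)
qed

lemma closed_feasible: "t \<ge> 0 \<Longrightarrow> closed (feasible g t)"
proof -
  assume "t \<ge> 0"
  have "continuous_on UNIV (\<lambda>y :: real^'n. (y, t))" by (intro continuous_intros)
  from continuous_on_compose2[OF continuous_on_g[OF smooth] this] \<open>t \<ge> 0\<close>
  have "continuous_on UNIV (\<lambda>y. g y t)" by auto
  from continuous_closed_preimage[OF this closed_UNIV closed_singleton[of 0]]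
  show ?thesis by (simp add: feasible_def vimage_def)
qed

text \<open>Confining set for the existence theorem. Feasibility is part of it because full rank,
  hence continuity of the field, is guaranteed only at feasible points.\<close>

definition "tube = {z. snd z \<ge> t0 \<and> fst z \<in> feasible g (snd z) \<and> norm (fst z - h (snd z)) \<le> r}"

lemma compact_tube: "compact (tube \<inter> UNIV \<times> {a..b})"
proof -
  \<comment> \<open>The time window is arbitrary while the tube begins at \<open>t0\<close>; the
    maximum also keeps times nonnegative, where \<open>h\<close> and \<open>g\<close> are
    continuous.\<close>
  let ?C = "(UNIV :: (real^'n) set) \<times> {max t0 a..b}"
  have conth: "continuous_on ?C (\<lambda>z. h (snd z))"
    using t0 by (intro continuous_on_compose2[OF h_cont] continuous_intros) auto
  have "continuous_on ?C (\<lambda>z. g (fst z) (snd z))"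
    by (rule continuous_on_subset[OF continuous_on_g[OF smooth]]) (use t0 in auto)
  from continuous_closed_preimage[OF this _ closed_singleton[of 0]]
  have 1: "closed (?C \<inter> (\<lambda>z. g (fst z) (snd z)) -` {0})" by (simp add: closed_Times)
  have "continuous_on ?C (\<lambda>z. norm (fst z - h (snd z)))" by (intro continuous_intros conth)
  from continuous_closed_preimage[OF this _ closed_atMost[of r]]
  have 2: "closed (?C \<inter> (\<lambda>z. norm (fst z - h (snd z))) -` {..r})" by (simp add: closed_Times)
  have eq: "tube \<inter> UNIV \<times> {a..b} = (?C \<inter> (\<lambda>z. g (fst z) (snd z)) -` {0}) \<inter> (?C \<inter> (\<lambda>z. norm (fst z - h (snd z))) -` {..r})"
    by (auto simp: tube_def feasible_def)
  have "compact (h ` {max t0 a..b})"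
    using t0 by (intro compact_continuous_image continuous_on_subset[OF h_cont]) auto
  then obtain R where R: "\<And>t. t \<in> {max t0 a..b} \<Longrightarrow> norm (h t) \<le> R"
    using compact_imp_bounded bounded_iff by (metis imageI)
  have "tube \<inter> UNIV \<times> {a..b} \<subseteq> cball 0 (R + r) \<times> {max t0 a..b}"
  proof
    fix z assume z: "z \<in> tube \<inter> UNIV \<times> {a..b}"
    then have "snd z \<in> {max t0 a..b}" "norm (fst z - h (snd z)) \<le> r" by (auto simp: tube_def)
    moreover from this have "norm (fst z) \<le> R + r"
      using R[of "snd z"] norm_triangle_sub[of "fst z" "h (snd z)"] by linarith
    ultimately show "z \<in> cball 0 (R + r) \<times> {max t0 a..b}" by (cases z) auto
  qed
  then have "bounded (tube \<inter> UNIV \<times> {a..b})"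
    by (rule bounded_subset[rotated]) (intro bounded_Times bounded_cball bounded_closed_interval)
  moreover have "closed (tube \<inter> UNIV \<times> {a..b})" unfolding eq using 1 2 by (rule closed_Int)
  ultimately show ?thesis by (simp add: compact_eq_bounded_closed)
qed

text \<open>The a priori hypothesis of the global theorem holds because a curve through regular
  points stays feasible, and a feasible solution stays in the ball.\<close>

lemma P_ODE_solution_exists: "\<exists>x. P_ODE_solution f g \<alpha> t0 x0 x"
proof -
  let ?W = "regular_points g \<inter> UNIV \<times> {t0..}"
  obtain x where "x t0 = x0"
    "\<And>t. t \<ge> t0 \<Longrightarrow> (x has_vector_derivative P_field f g \<alpha> (x t, t)) (at t within {t0..})"
  proof (rule confined_global_solution_exists[of t0 ?W "P_field f g \<alpha>" tube x0])
    show "openin (top_of_set (UNIV \<times> {t0..})) ?W"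
      using openin_regular_points[OF smooth] t0 unfolding openin_open by fastforce
    show "continuous_on ?W (P_field f g \<alpha>)"
      by (rule continuous_on_subset[OF continuous_on_P_field[OF smooth]]) auto
    show "tube \<subseteq> ?W" using regular t0 by (auto simp: tube_def)
    show "(x0, t0) \<in> tube" using x0 start_less by (simp add: tube_def)
    fix x T
    assume T: "t0 \<le> T" and x: "x t0 = x0"
      "\<And>t. t \<in> {t0..T} \<Longrightarrow> (x has_vector_derivative P_field f g \<alpha> (x t, t)) (at t within {t0..T})"
      "\<And>t. t \<in> {t0..T} \<Longrightarrow> (x t, t) \<in> ?W"
    have feas: "x t \<in> feasible g t" if "t \<in> {t0..T}" for t
      by (rule P_field_feasible[OF smooth t0 _ that x(2)]) (use x x0 in auto)
    from error_less_radius[OF x(1,2) this, of T] feas[of T] T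
    show "(x T, T) \<in> tube" by (simp add: tube_def)
  qed (use compact_tube in auto)
  then show ?thesis by (auto simp: P_ODE_solution_iff)
qed

text \<open>A start on the sphere of radius \<open>r\<close> is admitted here, so the strict inequality required by
  the barrier argument only becomes available after a short time.\<close>

lemma frozen_flow_decay:
  assumes t: "t \<ge> 0" and T: "0 \<le> T" and y0: "norm (\<xi> 0 - h t) \<le> r"
    and \<xi>: "\<And>s. s \<in> {0..T} \<Longrightarrow>
      (\<xi> has_vector_derivative - (Pmat g (\<xi> s) t *v grad (\<lambda>y. f y t) (\<xi> s))) (at s within {0..T})"
    and feas: "\<And>s. s \<in> {0..T} \<Longrightarrow> \<xi> s \<in> feasible g t"
  shows "norm (\<xi> T - h t) \<le> exp (- c * T) * norm (\<xi> 0 - h t)"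
proof -
  define e where "e s = \<xi> s - h t" for s
  define v where "v s = - (Pmat g (\<xi> s) t *v grad (\<lambda>y. f y t) (\<xi> s))" for s
  have e: "(e has_vector_derivative v s) (at s within {0..T})" if "s \<in> {0..T}" for s
    using \<xi>[OF that] by (auto simp: e_def[abs_def] v_def intro!: derivative_eq_intros)
  have dissipation: "e s \<bullet> v s \<le> - c * (norm (e s))\<^sup>2" if "s \<in> {0..T}" "norm (e s) \<le> r" for s
    using strongly_convex[OF t feas[OF that(1)]] that(2) by (simp add: e_def v_def)
  have conte: "continuous_on {0..T} (\<lambda>s. norm (e s))"
    using e by (intro continuous_on_norm)
      (meson continuous_on_eq_continuous_within has_vector_derivative_continuous)
  have decay: "norm (e \<tau>) \<le> exp (- c * \<tau>) * norm (e 0)"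
    if \<tau>: "\<tau> \<in> {0..T}" and ball: "\<And>s. s \<in> {0..\<tau>} \<Longrightarrow> norm (e s) \<le> r" for \<tau>
  proof -
    have "norm (e \<tau>) \<le> exp (integral {0..\<tau>} (\<lambda>_. - c)) * norm (e 0)
        + integral {0..\<tau>} (\<lambda>s. exp (integral {s..\<tau>} (\<lambda>_. - c)) * 0)"
    proof (rule gronwall_norm[where w = "\<lambda>_. 0" and e' = v])
      show "(e has_vector_derivative v s) (at s within {0..\<tau>})" if "s \<in> {0..\<tau>}" for s
        using that \<tau> by (intro has_vector_derivative_within_subset[OF e]) auto
      show "e s \<bullet> v s \<le> (norm (e s) * - c + 0) * norm (e s)" if "s \<in> {0..\<tau>}" for s
        using dissipation[OF _ ball[OF that]] that \<tau> by (simp add: power2_eq_square algebra_simps)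
    qed (use \<tau> in \<open>auto intro: absolutely_integrable_continuous_real\<close>)
    then show ?thesis using \<tau> by (simp add: mult.commute)
  qed
  have "norm (e s) \<le> r" if s: "s \<in> {0..T}" for s
  proof -
    obtain d where d: "d > 0" "\<And>s. 0 < s \<Longrightarrow> s < d \<Longrightarrow> s \<in> {0..T} \<Longrightarrow> norm (e s) < r"
    \<comment> \<open>For a nonzero initial error the squared norm has negative derivative at 0. At
      error 0 that derivative vanishes, but there the norm is below \<open>r\<close> anyway and
      continuity suffices.\<close>
    proof (cases "e 0 = 0")
      case True
      then have "norm (e 0) < r" using r_pos by simp
      then have "\<forall>\<^sub>F s in at 0 within {0..T}. norm (e s) < r"
        using conte T by (intro order_tendstoD(2)[of _ "norm (e 0)"]) (auto simp: continuous_on_def)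
      then show ?thesis using that by (force simp: eventually_at dist_real_def)
    next
      case False
      have "((\<lambda>s. e s \<bullet> e s) has_derivative (\<lambda>k. e 0 \<bullet> (k *\<^sub>R v 0) + (k *\<^sub>R v 0) \<bullet> e 0)) (at 0 within {0..T})"
        using e[of 0] T unfolding has_vector_derivative_def by (auto intro!: derivative_eq_intros)
      then have "((\<lambda>s. e s \<bullet> e s) has_real_derivative (2 * (e 0 \<bullet> v 0))) (at 0 within {0..T})"
        unfolding has_field_derivative_def
        by (rule has_derivative_eq_rhs) (auto simp: inner_commute fun_eq_iff algebra_simps)
      moreover have "2 * (e 0 \<bullet> v 0) < 0"
      proof -
        have "e 0 \<bullet> v 0 \<le> - c * (norm (e 0))\<^sup>2" using T y0 by (intro dissipation) (auto simp: e_def)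
        also have "\<dots> < 0" using c_pos False by simp
        finally show ?thesis by simp
      qed
      ultimately obtain d where "d > 0" "\<And>k. k > 0 \<Longrightarrow> 0 + k \<in> {0..T} \<Longrightarrow> k < d \<Longrightarrow> e (0 + k) \<bullet> e (0 + k) < e 0 \<bullet> e 0"
        using has_real_derivative_neg_dec_right by blast
      then have "norm (e s) < norm (e 0)" if "0 < s" "s < d" "s \<in> {0..T}" for s
        using that by (auto simp: norm_lt)
      with that[OF \<open>d > 0\<close>] y0 show ?thesis by (force simp: e_def)
    qed
    \<comment> \<open>A positive time below both \<open>d\<close> and \<open>s\<close>, at which the
      error is already strictly inside the ball and the barrier argument can begin.\<close>
    define a where "a = min (d / 2) (s / 2)"
    show ?thesis
    proof (cases "s = 0")
      case True
      then show ?thesis using y0 by (simp add: e_def)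
    next
      case False
      then have a: "0 < a" "a < d" "a < s" using d s by (auto simp: a_def min_def)
      have early: "norm (e \<sigma>) \<le> r" if "\<sigma> \<in> {0..a}" for \<sigma>
        using d(2)[of \<sigma>] that a s y0 by (cases "\<sigma> = 0") (auto simp: e_def)
      have "norm (e s) < r"
      proof (rule barrier[of a s "\<lambda>s. norm (e s)"])
        show "continuous_on {a..s} (\<lambda>s. norm (e s))"
          by (rule continuous_on_subset[OF conte]) (use a s in auto)
        show "norm (e a) < r" using d(2)[of a] a s by auto
        fix \<tau> assume \<tau>: "\<tau> \<in> {a..s}" and late: "\<And>s. s \<in> {a..\<tau>} \<Longrightarrow> norm (e s) \<le> r"
        \<comment> \<open>Decay is counted from time 0 rather than from \<open>a\<close>, so the
          ball condition is pieced together from \<open>early\<close> and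
          \<open>late\<close>.\<close>
        have "norm (e \<tau>) \<le> exp (- c * \<tau>) * norm (e 0)"
        proof (rule decay)
          show "\<tau> \<in> {0..T}" using \<tau> a s by auto
          show "norm (e \<sigma>) \<le> r" if "\<sigma> \<in> {0..\<tau>}" for \<sigma>
            using early[of \<sigma>] late[of \<sigma>] that by (cases "\<sigma> \<le> a") auto
        qed
        also have "\<dots> \<le> exp (- c * \<tau>) * r" using y0 by (intro mult_left_mono) (auto simp: e_def)
        also have "\<dots> < 1 * r" using c_pos a \<tau> r_pos by (intro mult_strict_right_mono) auto
        finally show "norm (e \<tau>) < r" by simp
      qed (use a in auto)
      then show ?thesis by simp
    qed
  qed
  then show ?thesis using decay[of T] T by (simp add: e_def)
qed

lemma ball_subset_region_of_attraction:
  assumes t: "t \<ge> 0"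
  shows "cball (h t) r \<inter> feasible g t \<subseteq> region_of_attraction f g t (h t)"
proof
  fix y0 assume "y0 \<in> cball (h t) r \<inter> feasible g t"
  then have y0: "y0 \<in> feasible g t" "norm (y0 - h t) \<le> r" by (auto simp: dist_norm norm_minus_commute)
  let ?F = "\<lambda>z. - (Pmat g (fst z) t *v grad (\<lambda>y. f y t) (fst z))"
  let ?W = "(UNIV \<times> {0::real..}) \<inter> (\<lambda>z. (fst z, t)) -` regular_points g"
  let ?K = "(feasible g t \<inter> cball (h t) r) \<times> {0::real..}"
  obtain \<xi> where \<xi>: "\<xi> 0 = y0" "\<And>s. s \<ge> 0 \<Longrightarrow> (\<xi> has_vector_derivative ?F (\<xi> s, s)) (at s within {0..})"
    "\<And>s. s \<ge> 0 \<Longrightarrow> (\<xi> s, s) \<in> ?K"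
  proof (rule confined_global_solution_exists[of 0 ?W ?F ?K y0])
    show "openin (top_of_set (UNIV \<times> {0..})) ?W"
      by (rule continuous_openin_preimage[OF _ _ openin_regular_points[OF smooth]])
         (use t in \<open>auto intro!: continuous_intros\<close>)
    show "continuous_on ?W ?F"
    proof -
      have "continuous_on ?W (\<lambda>z. (fst z, t))" by (intro continuous_intros)
      from continuous_on_compose2[OF continuous_on_projected_gradient[OF smooth] this] show ?thesis
        by (auto intro!: continuous_on_minus)
    qed
    have "compact ((feasible g t \<inter> cball (h t) r) \<times> ({0..} \<inter> {a..b}))" for a b :: real
      using closed_feasible[OF t] by (intro compact_Times closed_Int_compact) auto
    moreover have "?K \<inter> UNIV \<times> {a..b} = (feasible g t \<inter> cball (h t) r) \<times> ({0..} \<inter> {a..b})" for a b :: real by auto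
    ultimately show "compact (?K \<inter> UNIV \<times> {a..b})" for a b :: real by (simp only:)
    show "?K \<subseteq> ?W" using regular[OF t] by auto
    show "(y0, 0) \<in> ?K" using y0 by (simp add: dist_norm norm_minus_commute)
    fix \<xi> T
    assume T: "0 \<le> (T :: real)" and \<xi>: "\<xi> 0 = y0"
      "\<And>s. s \<in> {0..T} \<Longrightarrow> (\<xi> has_vector_derivative ?F (\<xi> s, s)) (at s within {0..T})"
      "\<And>s. s \<in> {0..T} \<Longrightarrow> (\<xi> s, s) \<in> ?W"
    have der: "(\<xi> has_vector_derivative - (Pmat g (\<xi> s) t *v grad (\<lambda>y. f y t) (\<xi> s))) (at s within {0..T})"
      if "s \<in> {0..T}" for s using \<xi>(2)[OF that] by simp
    have feas: "\<xi> s \<in> feasible g t" if "s \<in> {0..T}" for s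
      by (rule frozen_gradient_flow_feasible[OF smooth t _ that der]) (use \<xi> y0 in auto)
    have "norm (\<xi> T - h t) \<le> exp (- c * T) * norm (\<xi> 0 - h t)"
      by (rule frozen_flow_decay[OF t T _ der feas]) (use \<xi> y0 in auto)
    also have "\<dots> \<le> 1 * r" using c_pos T y0 \<xi> by (intro mult_mono) auto
    finally show "(\<xi> T, T) \<in> ?K" using feas[of T] T by (simp add: dist_norm norm_minus_commute)
  qed auto
  have der: "(\<xi> has_vector_derivative - (Pmat g (\<xi> s) t *v grad (\<lambda>y. f y t) (\<xi> s))) (at s within {0..})"
    if "s \<ge> 0" for s using \<xi>(2)[OF that] by simp
  have le: "norm (\<xi> T - h t) \<le> exp (- c * T) * norm (y0 - h t)" if "T \<ge> 0" for T
    using frozen_flow_decay[OF t that, of \<xi>] \<xi>(1,3) y0 has_vector_derivative_within_subset[OF der]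
    by auto
  have "((\<lambda>T. exp (- c * T) * norm (y0 - h t)) \<longlongrightarrow> 0) at_top"
  proof -
    have "filterlim (\<lambda>T. c * T) at_top at_top"
      using c_pos by (intro filterlim_tendsto_pos_mult_at_top[OF tendsto_const _ filterlim_ident])
    then have "filterlim (\<lambda>T. - (c * T)) at_bot at_top" by (simp add: filterlim_uminus_at_bot)
    then have "((\<lambda>T. exp (- c * T)) \<longlongrightarrow> 0) at_top" using filterlim_compose[OF exp_at_bot] by simp
    then show ?thesis by (rule tendsto_mult_left_zero)
  qed
  then have "((\<lambda>s. \<xi> s - h t) \<longlongrightarrow> 0) at_top"
    by (rule Lim_null_comparison[rotated]) (use le in \<open>auto simp: eventually_at_top_linorder\<close>)
  then have "(\<xi> \<longlongrightarrow> h t) at_top" by (simp add: LIM_zero_cancel)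
  moreover have "frozen_flow_solution f g t y0 \<xi>" using \<xi>(1) der by (simp add: frozen_flow_solution_def)
  ultimately show "y0 \<in> region_of_attraction f g t (h t)" using y0 by (auto simp: region_of_attraction_def)
qed

lemma P_ODE_solution_tracks:
  assumes "P_ODE_solution f g \<alpha> t0 x0 x"
  shows "tracks f g r x h" and "t \<ge> t0 \<Longrightarrow> norm (x t - h t) \<le> bound t"
proof -
  have x: "x t0 = x0" "\<And>t. t \<ge> t0 \<Longrightarrow> (x has_vector_derivative P_field f g \<alpha> (x t, t)) (at t within {t0..})"
    using assms by (auto simp: P_ODE_solution_iff)
  have feas: "x t \<in> feasible g t" if "t \<ge> t0" for t using P_ODE_feasible[OF x that] .
  have der: "(x has_vector_derivative P_field f g \<alpha> (x s, s)) (at s within {t0..b})" if "s \<in> {t0..b}" for s b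
    using that by (intro has_vector_derivative_within_subset[OF x(2)]) auto
  have ball: "norm (x t - h t) < r" if "t \<ge> t0" for t
    by (rule error_less_radius[OF x(1) der feas, of t]) (use that in auto)
  show "norm (x t - h t) \<le> bound t" if "t \<ge> t0"
    by (rule error_le_bound[OF that x(1) der feas]) (use ball in \<open>auto intro: less_imp_le\<close>)
  show "tracks f g r x h"
    unfolding tracks_def
  \<comment> \<open>Tracking asks for a positive time, and \<open>t0\<close> may be 0.\<close>
  proof (intro exI[of _ "t0 + 1"] conjI allI impI)
    show "t0 + 1 > 0" using t0 by simp
    fix t assume "t0 + 1 \<le> t"
    then have t: "t \<ge> t0" "t \<ge> 0" using t0 by auto
    show "x t \<in> cball (h t) r \<inter> feasible g t"
      using feas[OF t(1)] ball[OF t(1)] by (simp add: dist_norm norm_minus_commute)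
    show "cball (h t) r \<inter> feasible g t \<subseteq> region_of_attraction f g t (h t)"
      by (rule ball_subset_region_of_attraction[OF t(2)])
  qed
qed

end

theorem theorem5:
  fixes f :: "real^'n \<Rightarrow> real \<Rightarrow> real"
    and g :: "real^'n \<Rightarrow> real \<Rightarrow> real^'m"
    and h2 :: "real \<Rightarrow> real^'n"
    and \<alpha> t0 c2 r2 \<eta>1 \<eta>2 :: real
    and x0 e0 :: "real^'n"
    and \<gamma> \<delta>1 \<delta>2 :: "real \<Rightarrow> real"
  assumes "smooth_problem f g"
    and "always_feasible g"
    and "full_row_rank g"
    and "regular_trajectories f g"
    and "local_minimum_trajectory f g {0..} h2"
    and "\<alpha> > 0" and "t0 \<ge> 0" and "x0 \<in> feasible g t0"
    and "e0 = x0 - h2 t0"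
    and "one_point_strongly_convex f g c2 r2 h2"
    and "\<forall>t\<ge>t0. h2 differentiable (at t within {0..}) \<and> norm (time_deriv h2 t) \<le> \<gamma> t"
    and "\<forall>t\<ge>t0. \<forall>e. e + h2 t \<in> feasible g t \<and> norm e \<le> r2 \<longrightarrow>
           norm (Qmat g (e + h2 t) t *v time_deriv (g (e + h2 t)) t) \<le> \<delta>1 t * norm e + \<delta>2 t"
    and "\<forall>t\<ge>t0. \<delta>1 absolutely_integrable_on {t0..t}"
    and "\<forall>t\<ge>t0. (\<lambda>\<tau>. \<delta>2 \<tau> + \<gamma> \<tau>) absolutely_integrable_on {t0..t}"
    and "\<eta>1 > 0" and "\<eta>2 > 0"
    and "\<forall>s\<ge>t0. \<forall>t\<ge>s. integral {s..t} \<delta>1 \<le> \<eta>1 * (t - s) + \<eta>2"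
    and "bdd_above ((\<lambda>t. \<delta>2 t + \<gamma> t) ` {t0..})"
    and "norm (x0 - h2 t0) \<le> r2 / exp \<eta>2"
    and "\<alpha> \<le> c2 * r2 / (exp \<eta>2 * (SUP t\<in>{t0..}. \<delta>2 t + \<gamma> t) + \<eta>1 * r2)"
  shows "(\<exists>x. P_ODE_solution f g \<alpha> t0 x0 x) \<and>
    (\<forall>x. P_ODE_solution f g \<alpha> t0 x0 x \<longrightarrow>
       tracks f g r2 x h2 \<and>
       (\<forall>t\<ge>t0.
          norm (x t - h2 t)
            \<le> exp \<eta>2 * norm e0 * exp (- (c2 / \<alpha> - \<eta>1) * (t - t0))
              + exp \<eta>2 * integral {t0..t}
                  (\<lambda>\<tau>. exp (- (c2 / \<alpha> - \<eta>1) * (t - \<tau>)) * (\<delta>2 \<tau> + \<gamma> \<tau>)) \<and>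
          exp \<eta>2 * norm e0 * exp (- (c2 / \<alpha> - \<eta>1) * (t - t0))
              + exp \<eta>2 * integral {t0..t}
                  (\<lambda>\<tau>. exp (- (c2 / \<alpha> - \<eta>1) * (t - \<tau>)) * (\<delta>2 \<tau> + \<gamma> \<tau>)) \<le> r2))"
proof -
  interpret tracking_problem f g h2 \<alpha> t0 c2 r2 \<eta>1 \<eta>2 x0 \<gamma> \<delta>1 \<delta>2
    using assms by unfold_locales (auto simp: local_minimum_trajectory_def local_minimum_def)
  have bound: "exp \<eta>2 * norm e0 * exp (- (c2 / \<alpha> - \<eta>1) * (t - t0))
      + exp \<eta>2 * integral {t0..t} (\<lambda>\<tau>. exp (- (c2 / \<alpha> - \<eta>1) * (t - \<tau>)) * (\<delta>2 \<tau> + \<gamma> \<tau>)) = bound t" for t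
    using \<open>e0 = x0 - h2 t0\<close> by (simp only: bound_def \<kappa>_def w_def)
  show ?thesis
    unfolding bound using P_ODE_solution_exists P_ODE_solution_tracks bound_le by blast
qed

end
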